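(* Let $\tau=312$. Let $\{X_n\}_{n=1}^\infty$, $\{Y_n\}_{n=1}^\infty$ and $\{\Pi_I^{312}\}_I$ (indexed by finite blocks $I\subset\mathbb{N}$) be mutually independent random variables, where the $X_n$ are IID with $P(X_n=k)=\frac{C_k}{2\cdot 4^k}$, $k=0,1,2,\dots$, the $Y_n$ are IID with $P(Y_n=k)=(\frac12)^k$, $k\in\mathbb{N}$, and each $\Pi_I^{312}$ is uniformly distributed over the $312$-avoiding permutation images of $I$. Let $T_0^X=T_0^Y=0$, $T_n^X=\sum_{j=1}^nX_j$, $T_n^Y=\sum_{j=1}^nY_j$. Then, as $n\to\infty$, $\mu_n^{312}$ converges weakly, as probability measures on $S(\mathbb{N},\mathbb{N}^* )$, to the distribution of the random variable $$\ast_{n=1}^\infty\Big(\Pi^{312}_{[T_n^Y+T_{n-1}^X+1,\,T_n^Y+T_n^X]}*(T_n^Y+T_{n-1}^X)\Big)=\Pi^{312}_{[T_1^Y+1,\,T_1^Y+T_1^X]}*(T_1^Y)*\Pi^{312}_{[T_2^Y+T_1^X+1,\,T_2^Y+T_2^X]}*(T_2^Y+T_1^X)*\cdots,$$ which takes values (almost surely) in $S(\mathbb{N},\mathbb{N})-S_\infty$.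
   Context: $\mathbb{N}=\{1,2,\dots\}$ and $[n]=\{1,\dots,n\}$. $C_n=\frac{1}{n+1}\binom{2n}{n}$ is the $n$th Catalan number. $S_n$ is the set of permutations of $[n]$. For $\tau=\tau_1\cdots\tau_m\in S_m$, a finite sequence of distinct integers $\sigma_1,\dots,\sigma_l$ contains $\tau$ if there are indices $i_1<\cdots<i_m$ such that for all $1\le j,k\le m$, $\sigma_{i_j}<\sigma_{i_k}$ if and only if $\tau_j<\tau_k$; otherwise it avoids $\tau$. $S_n(\tau)$ is the set of $\tau$-avoiding permutations in $S_n$, and $\mu_n^\tau$ is the uniform probability measure on $S_n(\tau)$. $\mathbb{N}^*=\mathbb{N}\cup\{\infty\}$ carries the metric $d_{\mathbb{N}^*}(i,j)=\sum_{k=i}^{j-1}2^{-k}$ for $1\le i<j\le\infty$. $S(\mathbb{N},\mathbb{N}^* )$ is the set of functions $\sigma=\{\sigma_i\}_{i=1}^\infty$ from $\mathbb{N}$ to $\mathbb{N}^*$ that are injective on $\sigma^{-1}(\mathbb{N})$, with the metric $D(\sigma,\rho)=\sum_{i=1}^\infty 2^{-i}d_{\mathbb{N}^*}(\sigma_i,\rho_i)$; it is a compact metric space. $S(\mathbb{N},\mathbb{N})\subset S(\mathbb{N},\mathbb{N}^* )$ is the subset of injections $\mathbb{N}\to\mathbb{N}$, and $S_\infty\subset S(\mathbb{N},\mathbb{N})$ is the subset of bijections $\mathbb{N}\to\mathbb{N}$. $S_n$ is regarded as a subset of $S(\mathbb{N},\mathbb{N}^* )$ by setting $\sigma_j=j$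 for $j>n$, so $\mu_n^\tau$ is a probability measure on $S(\mathbb{N},\mathbb{N}^* )$. A block is a set of consecutive integers $[a,b]=\{a,\dots,b\}\subset\mathbb{N}$; $[a,a-1]=\emptyset$. A permutation image of a finite set $I\subset\mathbb{N}$ is a listing $(i_1\ i_2\cdots i_{|I|})$ of all the elements of $I$ in some order, each exactly once (the empty listing if $I=\emptyset$); it is $\tau$-avoiding if this sequence avoids $\tau$. $(a)$ denotes the permutation image of the singleton $\{a\}$. The symbol $*$ denotes concatenation of listings: an infinite concatenation of finite listings is read, from left to right, as the sequence of values $\sigma_1,\sigma_2,\sigma_3,\dots$ of a function $\sigma$ on $\mathbb{N}$. *)

theory Defs
  imports
    "HOL-Probability.Probability"
    "HOL-Combinatorics.Permutations"
    "HOL-Combinatorics.Multiset_Permutations"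
    "HOL-Library.Stream"
begin

definition catalan :: "nat \<Rightarrow> real" where
  "catalan n = real ((2 * n) choose n) / real (n + 1)"

text \<open>Patterns and sequences are lists, so the indices in pattern containment run from 0.\<close>

definition contains_pattern :: "nat list \<Rightarrow> nat list \<Rightarrow> bool" where
  "contains_pattern \<sigma> \<tau> \<longleftrightarrow>
     (\<exists>f :: nat \<Rightarrow> nat. strict_mono_on {..<length \<tau>} f \<and> f ` {..<length \<tau>} \<subseteq> {..<length \<sigma>} \<and>
        (\<forall>j<length \<tau>. \<forall>k<length \<tau>. \<sigma> ! f j < \<sigma> ! f k \<longleftrightarrow> \<tau> ! j < \<tau> ! k))"

definition avoids :: "nat list \<Rightarrow> nat list \<Rightarrow> bool" where
  "avoids \<sigma> \<tau> \<longleftrightarrow> \<not> contains_pattern \<sigma> \<tau>"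

definition avoiding_perms :: "nat \<Rightarrow> nat list \<Rightarrow> (nat \<Rightarrow> nat) set" where
  "avoiding_perms n \<tau> = {p. p permutes {1..n} \<and> avoids (map p [1..<Suc n]) \<tau>}"

definition avoiding_images :: "nat set \<Rightarrow> nat list \<Rightarrow> nat list set" where
  "avoiding_images I \<tau> = {xs \<in> permutations_of_set I. avoids xs \<tau>}"

definition blocks :: "nat set set" where
  "blocks = {{a..b} | a b. 1 \<le> a}"

text \<open>
  The positive integers are the elements \<open>\<ge> 1\<close> of \<^typ>\<open>nat\<close>, and the positive integers
  with \<open>\<infinity>\<close> adjoined are the elements \<open>\<ge> 1\<close> of \<^typ>\<open>enat\<close>. Functions on the positive integers
  are extensional functions on \<open>{1..}\<close>, so the argument 0 carries no information.
\<close>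

definition dist_Nstar :: "enat \<Rightarrow> enat \<Rightarrow> real" where
  "dist_Nstar i j = (\<Sum>\<^sub>\<infinity>k | min i j \<le> enat k \<and> enat k < max i j. (1 / 2) ^ k)"

definition S_NNstar :: "(nat \<Rightarrow> enat) set" where
  "S_NNstar = {\<sigma> \<in> {1..} \<rightarrow>\<^sub>E {1..}. inj_on \<sigma> {i \<in> {1..}. \<sigma> i \<noteq> \<infinity>}}"

definition S_NN :: "(nat \<Rightarrow> enat) set" where
  "S_NN = {\<sigma> \<in> {1..} \<rightarrow>\<^sub>E enat ` {1..}. inj_on \<sigma> {1..}}"

definition S_infinity :: "(nat \<Rightarrow> enat) set" where
  "S_infinity = {\<sigma> \<in> {1..} \<rightarrow>\<^sub>E enat ` {1..}. bij_betw \<sigma> {1..} (enat ` {1..})}"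

definition dist_S :: "(nat \<Rightarrow> enat) \<Rightarrow> (nat \<Rightarrow> enat) \<Rightarrow> real" where
  "dist_S \<sigma> \<rho> = (\<Sum>\<^sub>\<infinity>i\<in>{1..}. (1 / 2) ^ i * dist_Nstar (\<sigma> i) (\<rho> i))"

lemma has_sum_geometric:
  fixes a :: nat
  shows "((\<lambda>k. (1 / 2 :: real) ^ k) has_sum 2 * (1 / 2) ^ a) {a..}"
proof -
  have "(\<lambda>k. (1 / 2) ^ a * (1 / 2 :: real) ^ k) sums ((1 / 2) ^ a * (1 / (1 - 1 / 2)))"
    by (intro sums_mult geometric_sums) simp
  then have "((\<lambda>k. (1 / 2 :: real) ^ (k + a)) has_sum 2 * (1 / 2) ^ a) UNIV"
    by (intro norm_summable_imp_has_sum) (auto simp: power_add mult.commute sums_iff)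
  moreover have "bij_betw (\<lambda>k. k + a) UNIV {a..}"
    by (rule bij_betwI[of _ _ _ "\<lambda>k. k - a"]) auto
  ultimately show ?thesis
    using has_sum_reindex_bij_betw[of "\<lambda>k. k + a" UNIV "{a..}" "\<lambda>k. (1 / 2 :: real) ^ k"] by simp
qed

definition weight_Nstar :: "enat \<Rightarrow> real" where
  "weight_Nstar i = (case i of enat k \<Rightarrow> 2 * (1 / 2) ^ k | \<infinity> \<Rightarrow> 0)"

lemma dist_Nstar_less:
  assumes "i < j"
  shows "dist_Nstar i j = weight_Nstar i - weight_Nstar j"
proof -
  from assms obtain a where a: "i = enat a"
    by (cases i) auto
  show ?thesis
  proof (cases j)
    case (enat b)
    have "{k. min i j \<le> enat k \<and> enat k < max i j} = {a..} - {b..}"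
      using assms a enat by (auto simp: min_def max_def)
    moreover have "((\<lambda>k. (1 / 2 :: real) ^ k) has_sum 2 * (1 / 2) ^ a - 2 * (1 / 2) ^ b) ({a..} - {b..})"
      using assms a enat by (intro has_sum_Diff has_sum_geometric) auto
    ultimately show ?thesis
      unfolding dist_Nstar_def using a enat by (simp add: infsumI weight_Nstar_def)
  next
    case infinity
    have "{k. min i j \<le> enat k \<and> enat k < max i j} = {a..}"
      using a infinity by auto
    then show ?thesis
      unfolding dist_Nstar_def using a infinity infsumI[OF has_sum_geometric]
      by (simp add: weight_Nstar_def)
  qed
qed

lemma dist_Nstar_eq: "dist_Nstar i j = \<bar>weight_Nstar i - weight_Nstar j\<bar>"
proof -
  have mono: "weight_Nstar j < weight_Nstar i" if "i < j" for i j
    using that by (cases i; cases j) (auto simp: weight_Nstar_def intro: power_strict_decreasing)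
  consider "i < j" | "j < i" | "i = j"
    by (meson linorder_less_linear)
  then show ?thesis
  proof cases
    case 1
    then show ?thesis using mono[of i j] by (simp add: dist_Nstar_less)
  next
    case 2
    have "dist_Nstar i j = dist_Nstar j i"
      by (simp add: dist_Nstar_def min.commute max.commute)
    then show ?thesis using 2 mono[of j i] by (simp add: dist_Nstar_less)
  next
    case 3
    then have "{k. min i j \<le> enat k \<and> enat k < max i j} = {}"
      by auto
    with 3 show ?thesis
      by (simp only: dist_Nstar_def) simp
  qed
qed

lemma inj_weight_Nstar: "inj weight_Nstar"
proof (rule injI)
  fix i j assume "weight_Nstar i = weight_Nstar j"
  then show "i = j"
    by (cases i; cases j) (auto simp: weight_Nstar_def power_inject_exp' power_one_over)
qed

lemma dist_Nstar_nonneg: "0 \<le> dist_Nstar i j"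
  by (simp add: dist_Nstar_eq)

lemma dist_Nstar_le: "dist_Nstar i j \<le> 2"
proof -
  have "0 \<le> weight_Nstar k \<and> weight_Nstar k \<le> 2" for k
    by (cases k) (auto simp: weight_Nstar_def power_le_one)
  from this[of i] this[of j] show ?thesis
    unfolding dist_Nstar_eq by linarith
qed

lemma dist_S_summable:
  "(\<lambda>i. (1 / 2 :: real) ^ i * dist_Nstar (\<sigma> i) (\<rho> i)) summable_on {1..}"
proof (rule summable_on_comparison_test)
  show "(\<lambda>i. (1 / 2 :: real) ^ i * 2) summable_on {1..}"
    by (intro summable_on_cmult_left has_sum_imp_summable[OF has_sum_geometric])
qed (auto simp: dist_Nstar_le dist_Nstar_nonneg intro: mult_left_mono)

interpretation S_space: Metric_space S_NNstar dist_S
proof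
  fix \<sigma> \<rho> \<pi> :: "nat \<Rightarrow> enat"
  show "0 \<le> dist_S \<sigma> \<rho>"
    unfolding dist_S_def by (intro infsum_nonneg) (simp add: dist_Nstar_nonneg)
  show "dist_S \<sigma> \<rho> = dist_S \<rho> \<sigma>"
    by (simp add: dist_S_def dist_Nstar_eq abs_minus_commute)
  show "dist_S \<sigma> \<rho> = 0 \<longleftrightarrow> \<sigma> = \<rho>" if "\<sigma> \<in> S_NNstar" "\<rho> \<in> S_NNstar"
  proof
    assume eq: "dist_S \<sigma> \<rho> = 0"
    have ext: "\<sigma> \<in> extensional {1..}" "\<rho> \<in> extensional {1..}"
      using that by (auto simp: S_NNstar_def PiE_def)
    have "(1 / 2 :: real) ^ i * dist_Nstar (\<sigma> i) (\<rho> i) = 0" if "i \<in> {1..}" for i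
      by (rule nonneg_infsum_le_0D[OF _ dist_S_summable _ that])
         (use eq in \<open>auto simp: dist_S_def dist_Nstar_nonneg\<close>)
    then have "\<sigma> i = \<rho> i" if "i \<in> {1..}" for i
      using that inj_weight_Nstar by (auto simp: dist_Nstar_eq inj_eq)
    with ext show "\<sigma> = \<rho>"
      by (rule extensionalityI)
  qed (simp add: dist_S_def dist_Nstar_eq)
  show "dist_S \<sigma> \<pi> \<le> dist_S \<sigma> \<rho> + dist_S \<rho> \<pi>"
  proof -
    have "dist_S \<sigma> \<pi> \<le> (\<Sum>\<^sub>\<infinity>i\<in>{1..}. (1 / 2) ^ i * dist_Nstar (\<sigma> i) (\<rho> i) +
        (1 / 2) ^ i * dist_Nstar (\<rho> i) (\<pi> i))"
      unfolding dist_S_def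
    proof (intro infsum_mono summable_on_add dist_S_summable)
      fix i :: nat
      show "(1 / 2) ^ i * dist_Nstar (\<sigma> i) (\<pi> i) \<le>
          (1 / 2) ^ i * dist_Nstar (\<sigma> i) (\<rho> i) + (1 / 2) ^ i * dist_Nstar (\<rho> i) (\<pi> i)"
        unfolding distrib_left[symmetric] by (intro mult_left_mono) (auto simp: dist_Nstar_eq)
    qed
    then show ?thesis
      by (simp only: dist_S_def infsum_add[OF dist_S_summable dist_S_summable])
  qed
qed

definition top_S :: "(nat \<Rightarrow> enat) topology" where
  "top_S = Metric_space.mtopology S_NNstar dist_S"

definition borel_of_top :: "'a topology \<Rightarrow> 'a measure" where
  "borel_of_top T = sigma (topspace T) {U. openin T U}"

definition weakly_converges :: "'a topology \<Rightarrow> (nat \<Rightarrow> 'a measure) \<Rightarrow> 'a measure \<Rightarrow> bool" where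
  "weakly_converges T \<mu> \<nu> \<longleftrightarrow>
     (\<forall>n. sets (\<mu> n) = sets (borel_of_top T) \<and> prob_space (\<mu> n)) \<and>
     sets \<nu> = sets (borel_of_top T) \<and> prob_space \<nu> \<and>
     (\<forall>f :: 'a \<Rightarrow> real. continuous_map T euclideanreal f \<and> bounded (f ` topspace T) \<longrightarrow>
        (\<lambda>n. \<integral>x. f x \<partial>\<mu> n) \<longlonglongrightarrow> (\<integral>x. f x \<partial>\<nu>))"

text \<open>A permutation of \<open>{1..n}\<close> is the identity outside \<open>{1..n}\<close>, which is the convention
  by which it becomes a function on all positive integers.\<close>

definition embed_perm :: "(nat \<Rightarrow> nat) \<Rightarrow> nat \<Rightarrow> enat" where
  "embed_perm p = (\<lambda>i\<in>{1..}. enat (p i))"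

definition mu :: "nat list \<Rightarrow> nat \<Rightarrow> (nat \<Rightarrow> enat) measure" where
  "mu \<tau> n = distr (uniform_count_measure (avoiding_perms n \<tau>)) (borel_of_top top_S) embed_perm"

text \<open>\<open>L 1 * L 2 * L 3 * \<dots>\<close>, for nonempty listings \<open>L n\<close>; the function \<^const>\<open>flat\<close>
  concatenates a stream of nonempty lists, and streams are indexed from 0.\<close>

definition infinite_concat :: "(nat \<Rightarrow> nat list) \<Rightarrow> nat \<Rightarrow> enat" where
  "infinite_concat L = (\<lambda>i\<in>{1..}. enat (flat (smap L (fromN 1)) !! (i - 1)))"

definition partial_sum :: "(nat \<Rightarrow> 'a \<Rightarrow> nat) \<Rightarrow> nat \<Rightarrow> 'a \<Rightarrow> nat" where
  "partial_sum X n \<omega> = (\<Sum>j=1..n. X j \<omega>)"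

definition limit_perm ::
    "(nat \<Rightarrow> 'a \<Rightarrow> nat) \<Rightarrow> (nat \<Rightarrow> 'a \<Rightarrow> nat) \<Rightarrow> (nat set \<Rightarrow> 'a \<Rightarrow> nat list) \<Rightarrow> 'a \<Rightarrow> nat \<Rightarrow> enat" where
  "limit_perm X Y P \<omega> = infinite_concat (\<lambda>n.
     P {partial_sum Y n \<omega> + partial_sum X (n - 1) \<omega> + 1 .. partial_sum Y n \<omega> + partial_sum X n \<omega>} \<omega>
     @ [partial_sum Y n \<omega> + partial_sum X (n - 1) \<omega>])"

definition generated_events :: "'a measure \<Rightarrow> 'b measure \<Rightarrow> ('a \<Rightarrow> 'b) \<Rightarrow> 'a set set" where
  "generated_events M N f = {f -` A \<inter> space M | A. A \<in> sets N}"

text \<open>The three families take values in different types, so their joint mutual independence is stated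
  for the generated \<open>\<sigma>\<close>-algebras, indexed by a disjoint sum.\<close>

definition mutually_independent ::
    "'a measure \<Rightarrow> (nat \<Rightarrow> 'a \<Rightarrow> nat) \<Rightarrow> (nat \<Rightarrow> 'a \<Rightarrow> nat) \<Rightarrow> (nat set \<Rightarrow> 'a \<Rightarrow> nat list) \<Rightarrow> bool" where
  "mutually_independent M X Y P \<longleftrightarrow>
     prob_space.indep_sets M
       (case_sum (\<lambda>n. generated_events M (count_space UNIV) (X n))
         (case_sum (\<lambda>n. generated_events M (count_space UNIV) (Y n))
           (\<lambda>I. generated_events M (count_space UNIV) (P I))))
       ({1..} <+> ({1..} <+> blocks))"

end

theory Submission
  imports Defs
begin

text \<open>
  Cutting a 312-avoiding permutation of \<open>{1..n + 1}\<close> at the value 1 gives a pair \<open>(\<alpha>, \<beta>)\<close> of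
  312-avoiding permutations of complementary sizes, and every pair occurs: all values of \<open>\<alpha>\<close> lie
  below those of \<open>\<beta>\<close>. For a uniform permutation and large \<open>n\<close>, either \<open>\<alpha>\<close> or \<open>\<beta>\<close> is
  small. A small \<open>\<beta>\<close> is invisible in the limit and merely raises all values by 1; the number of
  times this happens is geometric and produces \<open>Y\<close>. A small \<open>\<alpha>\<close> produces a block
  \<open>\<Pi> * (T)\<close>, after which the procedure restarts with \<open>\<beta>\<close>.

  Only lower bounds are needed, because the weights of the limit add up to 1. As
  \<open>C (n + 1) \<le> 4 * C n\<close>, a cut with \<open>\<alpha>\<close> a given permutation of length \<open>j\<close> has
  probability at least \<open>1 / 4 ^ (j + 1)\<close> for every \<open>n\<close>, so no asymptotics of the Catalan numbers
  enters. For a functional \<open>g\<close> of finite words that increases under extension of the word,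
  this bounds the lower limit of the means of \<open>g\<close> from below by the expectation of \<open>g\<close>
  over the first \<open>k\<close> blocks of the limit. With \<open>g w\<close> the infimum of a continuous
  function over all sequences starting with \<open>w\<close>, letting \<open>k\<close> grow gives weak convergence.
\<close>

section \<open>Catalan numbers and 312-avoidance\<close>

lemma catalan_0 [simp]: "catalan 0 = 1"
  by (simp add: catalan_def)

lemma catalan_pos: "catalan n > 0"
  by (simp add: catalan_def)

lemma catalan_Suc: "(real n + 2) * catalan (Suc n) = 2 * (2 * real n + 1) * catalan n"
proof -
  have A: "real ((2 * Suc n) choose (Suc n)) = fact (2 * n + 2) / (fact (Suc n) * fact (Suc n))"
    by (subst binomial_fact) (auto simp: algebra_simps)
  have B: "real ((2 * n) choose n) = fact (2 * n) / (fact n * fact n)"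
    by (subst binomial_fact) (auto simp: algebra_simps)
  have C: "(fact (2 * n + 2) :: real) = (2 * real n + 2) * ((2 * real n + 1) * fact (2 * n))"
    by (simp add: algebra_simps)
  show ?thesis
    unfolding catalan_def A B C by (simp add: divide_simps) (simp add: algebra_simps)
qed

text \<open>The exact ratio of consecutive Catalan numbers is
  \<open>4 - 6 / (n + 2)\<close>.\<close>

lemma catalan_Suc_le: "catalan (Suc n) \<le> 4 * catalan n"
proof -
  have "(real n + 2) * catalan (Suc n) \<le> (real n + 2) * (4 * catalan n)"
    unfolding catalan_Suc using catalan_pos[of n] by (simp add: algebra_simps)
  then show ?thesis by simp
qed

lemma catalan_add_le: "catalan (n + k) \<le> 4 ^ k * catalan n"
proof (induction k)
  case (Suc k)
  then show ?case
    using catalan_Suc_le[of "n + k"] by simp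
qed simp

text \<open>The convolution is Gosper-summable, so even its partial sums have a closed form.\<close>

lemma catalan_partial_convolution:
  assumes "k \<le> n + 1"
  shows "(\<Sum>i<k. catalan i * catalan (n - i)) = catalan (n + 1) / 2 +
    catalan k * catalan (n + 1 - k) * (real k + 1) * (real n - real k + 2) * (2 * real k - real n - 1) /
      (2 * (real n + 1) * (real n + 2))"
  using assms
proof (induction k)
  case 0
  then show ?case by (simp add: divide_simps) (simp add: algebra_simps)
next
  case (Suc k)
  then obtain m where m: "n = k + m" by (auto simp: le_iff_add)
  \<comment> \<open>\<open>catalan k\<close> and \<open>catalan m\<close> stay as atoms; the
    recurrence eliminates both successors, and the induction step becomes an identity of rational
    functions in \<open>k\<close> and \<open>m\<close>.\<close>
  define a b where "a = catalan k" and "b = catalan m"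
  have a: "catalan (Suc k) = 2 * (2 * real k + 1) * a / (real k + 2)"
    using catalan_Suc[of k] by (simp add: field_simps a_def)
  have b: "catalan (Suc m) = 2 * (2 * real m + 1) * b / (real m + 2)"
    using catalan_Suc[of m] by (simp add: field_simps b_def)
  have pos: "real k + real m + 1 > 0" "real k + real m + 2 > 0" "real k + 2 > 0" "real m + 2 > 0"
    by auto
  have "(\<Sum>i<Suc k. catalan i * catalan (n - i)) = catalan (n + 1) / 2 +
      a * catalan (Suc m) * (real k + 1) * (real m + 2) * (real k - real m - 1) /
      (2 * (real k + real m + 1) * (real k + real m + 2)) + a * b"
    using Suc by (simp add: m a_def b_def)
  also have "\<dots> = catalan (n + 1) / 2 +
      catalan (Suc k) * b * (real k + 2) * (real m + 1) * (real k - real m + 1) /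
      (2 * (real k + real m + 1) * (real k + real m + 2))"
    unfolding a b using pos
    apply (simp add: divide_simps)
    apply (simp add: algebra_simps)
    done
  finally show ?case
    by (simp add: m b_def algebra_simps)
qed

lemma catalan_convolution: "(\<Sum>i\<le>n. catalan i * catalan (n - i)) = catalan (Suc n)"
proof -
  \<comment> \<open>At \<open>k = n + 1\<close> the correction term of the closed form is the other
    half of \<open>catalan (n + 1)\<close>; here \<open>x\<close> stands for \<open>n\<close> and
    \<open>y\<close> for \<open>k\<close>.\<close>
  have "c / 2 + c * (y + 1) * (x - y + 2) * (2 * y - x - 1) / (2 * (x + 1) * (x + 2)) = c"
    if "x \<ge> 0" "y = x + 1" for c x y :: real
    using that by (simp add: divide_simps) (simp add: algebra_simps)
  from this[of "real n" "real (Suc n)" "catalan (Suc n)"] show ?thesis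
    using catalan_partial_convolution[of "Suc n" n] by (simp add: lessThan_Suc_atMost)
qed

text \<open>The head of a list can only play the role of 3, so the tail must contain no increasing
  pair below it. The structural recursion suits concatenation and shifts.\<close>

fun avoids312 :: "nat list \<Rightarrow> bool" where
  "avoids312 [] \<longleftrightarrow> True"
| "avoids312 (c # xs) \<longleftrightarrow> sorted_wrt (\<lambda>a b. \<not> (a < b \<and> b < c)) xs \<and> avoids312 xs"

lemma avoids312_iff_nth:
  "avoids312 xs \<longleftrightarrow>
    (\<forall>i j k. i < j \<and> j < k \<and> k < length xs \<longrightarrow> \<not> (xs ! j < xs ! k \<and> xs ! k < xs ! i))"
proof (induction xs)
  case (Cons c xs)
  \<comment> \<open>The letters 1 and 2 never sit at the head: \<open>j\<close> and \<open>k\<close>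
    are lowered into the tail while \<open>i\<close> still indexes the whole list, which turns
    \<open>i < j\<close> into \<open>i < Suc j\<close>.\<close>
  have "(\<forall>i j k. i < j \<and> j < k \<and> k < length (c # xs) \<longrightarrow>
      \<not> ((c # xs) ! j < (c # xs) ! k \<and> (c # xs) ! k < (c # xs) ! i)) \<longleftrightarrow>
    (\<forall>i j k. i < Suc j \<and> j < k \<and> k < length xs \<longrightarrow>
      \<not> (xs ! j < xs ! k \<and> xs ! k < (c # xs) ! i))" (is "?L = ?R")
  proof
    assume ?L
    show ?R
    proof (intro allI impI)
      fix i j k assume "i < Suc j \<and> j < k \<and> k < length xs"
      then show "\<not> (xs ! j < xs ! k \<and> xs ! k < (c # xs) ! i)"
        using \<open>?L\<close>[rule_format, of i "Suc j" "Suc k"] by simp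
    qed
  next
    assume R: ?R
    show ?L
    proof (intro allI impI)
      fix i j k assume "i < j \<and> j < k \<and> k < length (c # xs)"
      then show "\<not> ((c # xs) ! j < (c # xs) ! k \<and> (c # xs) ! k < (c # xs) ! i)"
        using R[rule_format, of i "j - 1" "k - 1"] by (cases j; cases k) auto
    qed
  qed
  also have "?R \<longleftrightarrow> (\<forall>j k. j < k \<and> k < length xs \<longrightarrow> \<not> (xs ! j < xs ! k \<and> xs ! k < c)) \<and>
     (\<forall>i j k. i < j \<and> j < k \<and> k < length xs \<longrightarrow> \<not> (xs ! j < xs ! k \<and> xs ! k < xs ! i))"
    (is "_ \<longleftrightarrow> ?R1 \<and> ?R2")
  proof (intro iffI conjI)
    assume R: ?R
    show ?R1 using R[rule_format, of 0] by auto
    show ?R2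
    proof (intro allI impI)
      fix i j k assume "i < j \<and> j < k \<and> k < length xs"
      then show "\<not> (xs ! j < xs ! k \<and> xs ! k < xs ! i)"
        using R[rule_format, of "Suc i" j k] by simp
    qed
  next
    assume R: "?R1 \<and> ?R2"
    show ?R
    proof (intro allI impI)
      fix i j k assume "i < Suc j \<and> j < k \<and> k < length xs"
      then show "\<not> (xs ! j < xs ! k \<and> xs ! k < (c # xs) ! i)"
        using R by (cases i) auto
    qed
  qed
  moreover have R1: "sorted_wrt (\<lambda>a b. \<not> (a < b \<and> b < c)) xs \<longleftrightarrow> ?R1"
    unfolding sorted_wrt_iff_nth_less by (intro iffI allI impI) (auto dest: less_trans)
  ultimately show ?case
    unfolding avoids312.simps(2) Cons.IH by (simp only:)
qed simp

lemma avoids_312: "avoids xs [3, 1, 2] \<longleftrightarrow> avoids312 xs"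
proof -
  have "contains_pattern xs [3, 1, 2] \<longleftrightarrow>
    (\<exists>i j k. i < j \<and> j < k \<and> k < length xs \<and> xs ! j < xs ! k \<and> xs ! k < xs ! i)"
  proof
    assume "contains_pattern xs [3, 1, 2]"
    then obtain f where f: "strict_mono_on {..<3} f" "f ` {..<3} \<subseteq> {..<length xs}"
      and iff: "\<And>j k. j < 3 \<Longrightarrow> k < 3 \<Longrightarrow>
        xs ! f j < xs ! f k \<longleftrightarrow> ([3, 1, 2] ! j :: nat) < [3, 1, 2] ! k"
      unfolding contains_pattern_def by (auto simp: numeral_3_eq_3)
    show "\<exists>i j k. i < j \<and> j < k \<and> k < length xs \<and> xs ! j < xs ! k \<and> xs ! k < xs ! i"
    proof (intro exI conjI)
      show "f 0 < f 1" "f 1 < f 2" "f 2 < length xs"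
        using f by (auto simp: strict_mono_on_def image_subset_iff)
      show "xs ! f 1 < xs ! f 2" "xs ! f 2 < xs ! f 0"
        using iff[of 1 2] iff[of 2 0] by (auto simp: numeral_2_eq_2)
    qed
  next
    assume "\<exists>i j k. i < j \<and> j < k \<and> k < length xs \<and> xs ! j < xs ! k \<and> xs ! k < xs ! i"
    then obtain i j k where ijk: "i < j" "j < k" "k < length xs" "xs ! j < xs ! k" "xs ! k < xs ! i"
      by auto
    define f where "f = (\<lambda>m::nat. if m = 0 then i else if m = 1 then j else k)"
    have f: "f 0 = i" "f (Suc 0) = j" "f (Suc (Suc 0)) = k"
      by (simp_all add: f_def)
    have "strict_mono_on {..<length [3, 1, 2::nat]} f"
      using ijk by (auto simp: strict_mono_on_def less_Suc_eq f)
    moreover have "f ` {..<length [3, 1, 2::nat]} \<subseteq> {..<length xs}"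
      using ijk by (auto simp: less_Suc_eq f)
    moreover have "\<forall>a<length [3, 1, 2::nat]. \<forall>b<length [3, 1, 2]. xs ! f a < xs ! f b \<longleftrightarrow> [3, 1, 2::nat] ! a < [3, 1, 2] ! b"
      using ijk by (simp add: All_less_Suc f)
    ultimately show "contains_pattern xs [3, 1, 2]"
      unfolding contains_pattern_def by blast
  qed
  then show ?thesis
    unfolding avoids_def avoids312_iff_nth by blast
qed

text \<open>A pattern straddling the cut splits as 3 | 12 or as 31 | 2; these are the last two
  conditions.\<close>

lemma avoids312_append:
  "avoids312 (xs @ ys) \<longleftrightarrow> avoids312 xs \<and> avoids312 ys \<and>
    (\<forall>c\<in>set xs. sorted_wrt (\<lambda>a b. \<not> (a < b \<and> b < c)) ys) \<and>
    (\<forall>b\<in>set ys. sorted_wrt (\<lambda>c a. \<not> (a < b \<and> b < c)) xs)"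
  by (induction xs) (auto simp: sorted_wrt_append)

lemma avoids312_map_add [simp]: "avoids312 (map ((+) k) xs) \<longleftrightarrow> avoids312 xs"
  by (induction xs) (auto simp: sorted_wrt_map)

lemma sorted_wrtI: "(\<And>a b. a \<in> set xs \<Longrightarrow> b \<in> set xs \<Longrightarrow> R a b) \<Longrightarrow> sorted_wrt R xs"
  by (simp add: sorted_wrt_iff_nth_less)

text \<open>The minimum serves as the 1: an entry before it and a smaller entry after it complete a
  312. Conversely, a crossing pattern has its 3 before and its 2 after the minimum, which the order
  of the two sides forbids.\<close>

lemma avoids312_split_at_min:
  assumes "\<forall>v\<in>set xs \<union> set ys. m < v"
  shows "avoids312 (xs @ m # ys) \<longleftrightarrow>
    avoids312 xs \<and> avoids312 ys \<and> (\<forall>c\<in>set xs. \<forall>b\<in>set ys. c \<le> b)" (is "?L \<longleftrightarrow> ?R")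
proof
  assume ?L
  then have *: "avoids312 xs" "avoids312 (m # ys)"
      "\<forall>c\<in>set xs. sorted_wrt (\<lambda>a b. \<not> (a < b \<and> b < c)) (m # ys)"
    unfolding avoids312_append by blast+
  have "c \<le> b" if "c \<in> set xs" "b \<in> set ys" for c b
  proof -
    have "\<not> (m < b \<and> b < c)" using *(3)[rule_format, OF that(1)] that(2) by simp
    then show ?thesis using assms that by (auto simp: not_less)
  qed
  with * show ?R by simp
next
  assume R: ?R
  have 1: "avoids312 (m # ys)"
    unfolding avoids312.simps
  proof (intro conjI sorted_wrtI)
    show "\<not> (a < b \<and> b < m)" if "a \<in> set ys" "b \<in> set ys" for a b
      using assms that by (simp add: not_less less_imp_le)
    show "avoids312 ys" using R by simp
  qed
 have 2: "sorted_wrt (\<lambda>a b. \<not> (a < b \<and> b < c)) (m # ys)" if "c \<in> set xs" for c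
  proof (rule sorted_wrtI)
    fix a b assume "a \<in> set (m # ys)" "b \<in> set (m # ys)"
    then show "\<not> (a < b \<and> b < c)"
      using R assms that by (metis UnCI leD less_asym set_ConsD)
  qed
  have 3: "sorted_wrt (\<lambda>c a. \<not> (a < b \<and> b < c)) xs" if "b \<in> set (m # ys)" for b
  proof (rule sorted_wrtI)
    fix c a assume "c \<in> set xs" "a \<in> set xs"
    then show "\<not> (a < b \<and> b < c)"
      using R assms that by (metis UnCI leD less_asym set_ConsD)
  qed
  show ?L
    unfolding avoids312_append by (intro conjI ballI 1 2 3) (use R in simp_all)
qed

section \<open>Decomposition at the value 1\<close>

definition avoiders :: "nat \<Rightarrow> nat list set" where
  "avoiders n = {xs. set xs = {1..n} \<and> distinct xs \<and> avoids312 xs}"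

definition glue :: "nat \<Rightarrow> nat list \<Rightarrow> nat list \<Rightarrow> nat list" where
  "glue y \<alpha> w = map ((+) y) \<alpha> @ y # map ((+) (y + length \<alpha>)) w"

lemma avoiders_0 [simp]: "avoiders 0 = {[]}"
  by (auto simp: avoiders_def)

lemma avoiding_images_312:
  "avoiding_images I [3, 1, 2] = {xs. set xs = I \<and> distinct xs \<and> avoids312 xs}"
  unfolding avoiding_images_def permutations_of_set_def avoids_312 by blast

lemma avoiders_eq: "avoiders n = avoiding_images {1..n} [3, 1, 2]"
  unfolding avoiding_images_312 avoiders_def ..

lemma finite_avoiders [simp]: "finite (avoiders n)"
  by (simp add: avoiders_eq avoiding_images_def)

lemma length_avoiders: "xs \<in> avoiders n \<Longrightarrow> length xs = n"
  using distinct_card[of xs] by (simp add: avoiders_def)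

lemma image_add_atLeastAtMost_1: "(+) k ` {1..n} = {Suc k..k + n :: nat}"
  using image_add_atLeastAtMost[of k 1 n] by (simp del: image_add_atLeastAtMost)

lemma glue_mem_avoiders:
  assumes "\<alpha> \<in> avoiders j" "\<beta> \<in> avoiders m"
  shows "glue 1 \<alpha> \<beta> \<in> avoiders (Suc (j + m))"
proof -
  have len: "length \<alpha> = j" using assms by (simp add: length_avoiders)
  have \<alpha>: "set (map ((+) 1) \<alpha>) = {2..Suc j}"
    using assms by (simp add: avoiders_def numeral_2_eq_2)
  have \<beta>: "set (map ((+) (1 + j)) \<beta>) = {j + 2..Suc (j + m)}"
    using assms image_add_atLeastAtMost_1[of "Suc j" m] by (simp add: avoiders_def)
  have "avoids312 (map ((+) 1) \<alpha> @ 1 # map ((+) (1 + j)) \<beta>)"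
    by (subst avoids312_split_at_min) (use assms in \<open>auto simp: \<alpha> \<beta> avoiders_def\<close>)
  moreover have "distinct (map ((+) 1) \<alpha> @ 1 # map ((+) (1 + j)) \<beta>)"
    unfolding distinct_append distinct.simps \<alpha> \<beta>
    using assms by (auto simp: distinct_map avoiders_def)
  moreover have "set (map ((+) 1) \<alpha> @ 1 # map ((+) (1 + j)) \<beta>) = {1..Suc (j + m)}"
    unfolding set_append list.set(2) \<alpha> \<beta> by auto
  ultimately show ?thesis
    unfolding avoiders_def glue_def len by simp
qed

text \<open>Serves to read off the value sets on both sides of the value 1 from the number of
  entries before it.\<close>

lemma initial_segment:
  fixes a b :: nat
  assumes "U \<union> V = {a..b}" "\<forall>u\<in>U. \<forall>v\<in>V. u < v"
  shows "U = {a..<a + card U}" "V = {a + card U..b}"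
proof -
  have "U = {a..<a + card U} \<and> V = {a + card U..b}"
  proof (cases "U = {}")
    case False
    have fin: "finite U"
      using assms(1) by (metis finite_Un finite_atLeastAtMost)
    have "U = {a..Max U}"
    proof
      show "U \<subseteq> {a..Max U}"
        using assms(1) fin by fastforce
      show "{a..Max U} \<subseteq> U"
      proof
        fix x assume x: "x \<in> {a..Max U}"
        moreover have "Max U \<in> U" using fin False by simp
        ultimately have "x \<in> U \<union> V"
          using assms(1) by (metis (no_types, lifting) UnCI atLeastAtMost_iff order_trans)
        moreover have "x \<notin> V"
          using x assms(2) \<open>Max U \<in> U\<close> by (meson atLeastAtMost_iff leD)
        ultimately show "x \<in> U" by simp
      qed
    qed
    then obtain M where U: "U = {a..M}" by blast
    with False have "a \<le> M" by auto
    then have "a + card U = Suc M" using U by simp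
    moreover have "V = {a..b} - U" using assms by auto
    moreover have "M \<le> b" using U \<open>a \<le> M\<close> assms(1) by auto
    ultimately show ?thesis using U by auto
  qed (use assms in auto)
  then show "U = {a..<a + card U}" "V = {a + card U..b}" by auto
qed

text \<open>Surjectivity of the gluing: by \<open>avoids312_split_at_min\<close> the entries before
  1 lie below those after it, and \<open>initial_segment\<close> then makes both sides shifted
  permutations.\<close>

lemma avoiders_Suc_cases:
  assumes "xs \<in> avoiders (Suc n)"
  obtains j \<alpha> \<beta> where "j \<le> n" "\<alpha> \<in> avoiders j" "\<beta> \<in> avoiders (n - j)" "xs = glue 1 \<alpha> \<beta>"
proof -
  have xs: "set xs = {1..Suc n}" "distinct xs" "avoids312 xs"
    using assms by (auto simp: avoiders_def)
  then have "1 \<in> set xs" by simp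
  then obtain us vs where split: "xs = us @ 1 # vs"
    by (meson split_list)
  have un: "set us \<union> set vs = {2..Suc n}"
  proof -
    have "set us \<union> set vs = set xs - {1}" using split xs(2) by auto
    also have "\<dots> = {2..Suc n}" unfolding xs by auto
    finally show ?thesis .
  qed
  then have gt: "\<forall>v\<in>set us \<union> set vs. 1 < v" by auto
  have av: "avoids312 us" "avoids312 vs" and le: "\<forall>c\<in>set us. \<forall>b\<in>set vs. c \<le> b"
    using xs(3) unfolding split avoids312_split_at_min[OF gt] by blast+
  have lt: "\<forall>c\<in>set us. \<forall>b\<in>set vs. c < b"
    using le xs(2) unfolding split by (fastforce simp: order_less_le)
  define j where "j = length us"
  have card: "card (set us) = j"
    using xs(2) split by (simp add: distinct_card j_def)
  have us: "set us = {2..<2 + j}" and vs: "set vs = {2 + j..Suc n}"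
    using initial_segment[OF un lt] by (simp_all add: card)
  have j: "j \<le> n"
    using xs(1,2) distinct_card[of xs] by (simp add: split j_def)
  define \<alpha> where "\<alpha> = map (\<lambda>x. x - 1) us"
  define \<beta> where "\<beta> = map (\<lambda>x. x - (1 + j)) vs"
  have \<alpha>: "map ((+) 1) \<alpha> = us"
    unfolding \<alpha>_def map_map by (rule map_idI) (auto simp: us)
  have \<beta>: "map ((+) (1 + j)) \<beta> = vs"
    unfolding \<beta>_def map_map by (rule map_idI) (auto simp: vs)
  have "set \<alpha> = {1..j}"
    unfolding \<alpha>_def set_map us by (auto simp: image_iff intro!: bexI[of _ "Suc _"])
  moreover have "set \<beta> = {1..n - j}"
    unfolding \<beta>_def set_map vs using j by (auto simp: image_iff intro!: bexI[of _ "_ + (1 + j)"])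
  moreover have "distinct \<alpha>" "avoids312 \<alpha>"
    using xs(2) av avoids312_map_add[of 1 \<alpha>] split by (auto simp flip: \<alpha> simp: distinct_map)
  moreover have "distinct \<beta>" "avoids312 \<beta>"
    using xs(2) av avoids312_map_add[of "1 + j" \<beta>] split by (auto simp flip: \<beta> simp: distinct_map)
  moreover have "xs = glue 1 \<alpha> \<beta>"
    unfolding split glue_def \<alpha> using \<beta> by (simp add: \<alpha>_def j_def)
  ultimately show ?thesis
    using that j by (auto simp: avoiders_def)
qed

text \<open>The value 1 occurs only at the joint, so its position recovers both parts.\<close>

lemma glue_1_inject:
  assumes "\<alpha> \<in> avoiders j" "\<beta> \<in> avoiders m"
    and "glue 1 \<alpha> \<beta> = glue 1 \<alpha>' \<beta>'"
  shows "\<alpha> = \<alpha>'" "\<beta> = \<beta>'"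
proof -
  have "1 \<notin> set (map ((+) 1) \<alpha>)" "1 \<notin> set (map ((+) (1 + length \<alpha>)) \<beta>)"
    using assms(1,2) by (auto simp: avoiders_def)
  with assms(3) have *: "map ((+) 1) \<alpha> = map ((+) 1) \<alpha>'"
      "map ((+) (1 + length \<alpha>)) \<beta> = map ((+) (1 + length \<alpha>')) \<beta>'"
    by (simp_all only: glue_def append_Cons_eq_iff simp_thms)
  have inj: "map ((+) k) u = map ((+) k) v \<longleftrightarrow> u = v" for k :: nat and u v
    by (simp add: inj_map_eq_map)
  from * show "\<alpha> = \<alpha>'" "\<beta> = \<beta>'"
    by (auto simp only: inj)
qed

lemma sum_avoiders_Suc:
  "(\<Sum>xs\<in>avoiders (Suc n). g xs) =
    (\<Sum>j\<le>n. \<Sum>\<alpha>\<in>avoiders j. \<Sum>\<beta>\<in>avoiders (n - j). g (glue 1 \<alpha> \<beta>))"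
proof -
  let ?S = "SIGMA j:{..n}. avoiders j \<times> avoiders (n - j)"
  let ?f = "\<lambda>(j :: nat, \<alpha>, \<beta>). glue 1 \<alpha> \<beta>"
  have "bij_betw ?f ?S (avoiders (Suc n))"
    unfolding bij_betw_def
  proof
    show "inj_on ?f ?S"
    proof (rule inj_onI, clarsimp, intro conjI)
      fix j \<alpha> \<beta> j' \<alpha>' \<beta>'
      assume *: "\<alpha> \<in> avoiders j" "\<alpha>' \<in> avoiders j'" "\<beta> \<in> avoiders (n - j)"
        "glue (Suc 0) \<alpha> \<beta> = glue (Suc 0) \<alpha>' \<beta>'"
      then show "\<alpha> = \<alpha>'" "\<beta> = \<beta>'" using glue_1_inject[of \<alpha> j \<beta> "n - j" \<alpha>' \<beta>'] by simp_all
      with * show "j = j'" by (metis length_avoiders)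
    qed
    show "?f ` ?S = avoiders (Suc n)"
    proof
      show "?f ` ?S \<subseteq> avoiders (Suc n)"
        using glue_mem_avoiders by fastforce
      show "avoiders (Suc n) \<subseteq> ?f ` ?S"
      proof
        fix xs assume "xs \<in> avoiders (Suc n)"
        then obtain j \<alpha> \<beta> where
          "j \<le> n" "\<alpha> \<in> avoiders j" "\<beta> \<in> avoiders (n - j)" "xs = glue 1 \<alpha> \<beta>"
          by (rule avoiders_Suc_cases)
        then show "xs \<in> ?f ` ?S"
          by (intro image_eqI[of _ _ "(j, \<alpha>, \<beta>)"]) auto
      qed
    qed
  qed
  then have "(\<Sum>xs\<in>avoiders (Suc n). g xs) = (\<Sum>z\<in>?S. g (?f z))"
    by (rule sum.reindex_bij_betw[symmetric])
  also have "\<dots> = (\<Sum>j\<le>n. \<Sum>(\<alpha>, \<beta>)\<in>avoiders j \<times> avoiders (n - j). g (glue 1 \<alpha> \<beta>))"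
    by (subst sum.Sigma) (auto simp: split_def)
  finally show ?thesis
    by (simp add: sum.cartesian_product)
qed

text \<open>With \<open>g = 1\<close> the cut gives the Catalan recursion, which
  \<open>catalan_convolution\<close> solves.\<close>

lemma card_avoiders: "real (card (avoiders n)) = catalan n"
proof (induction n rule: less_induct)
  case (less n)
  show ?case
  proof (cases n)
    case (Suc m)
    have "real (card (avoiders n)) = (\<Sum>xs\<in>avoiders (Suc m). 1)"
      by (simp add: Suc)
    also have "\<dots> = (\<Sum>j\<le>m. real (card (avoiders j)) * real (card (avoiders (m - j))))"
      unfolding sum_avoiders_Suc by simp
    also have "\<dots> = (\<Sum>j\<le>m. catalan j * catalan (m - j))"
      by (intro sum.cong refl) (use less Suc in auto)
    finally show ?thesis
      by (simp add: catalan_convolution Suc)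
  qed simp
qed

lemma avoiders_nonempty [simp]: "avoiders n \<noteq> {}"
  using card_avoiders[of n] catalan_pos[of n] by auto

section \<open>Lower limits of means over 312-avoiding permutations\<close>

definition prefix_mono :: "(nat list \<Rightarrow> ennreal) \<Rightarrow> bool" where
  "prefix_mono g \<longleftrightarrow> (\<forall>u v. g u \<le> g (u @ v))"

definition avoider_mean :: "nat \<Rightarrow> (nat list \<Rightarrow> ennreal) \<Rightarrow> ennreal" where
  "avoider_mean n g = ennreal (1 / catalan n) * (\<Sum>xs\<in>avoiders n. g xs)"

definition avoider_liminf :: "(nat list \<Rightarrow> ennreal) \<Rightarrow> ennreal" where
  "avoider_liminf g = liminf (\<lambda>n. avoider_mean n g)"

text \<open>The lower bound for the probability of a cut with \<open>\<alpha>\<close> before the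
  value 1. It is half of \<open>P(X = j) / catalan j\<close> at \<open>j = length \<alpha>\<close>;
  the factor one half is the probability that \<open>\<alpha>\<close>, and not
  \<open>\<beta>\<close>, is the small part.\<close>

definition avoider_weight :: "nat list \<Rightarrow> ennreal" where
  "avoider_weight \<alpha> = (if \<alpha> \<in> avoiders (length \<alpha>) then ennreal (1 / 4 ^ Suc (length \<alpha>)) else 0)"

lemma avoider_weight_eq: "\<alpha> \<in> avoiders j \<Longrightarrow> avoider_weight \<alpha> = ennreal (1 / 4 ^ Suc j)"
  by (simp add: avoider_weight_def length_avoiders)

lemma prefix_mono_glue: "prefix_mono g \<Longrightarrow> prefix_mono (\<lambda>w. g (glue y \<alpha> w))"
  unfolding prefix_mono_def glue_def by (metis append.assoc append_Cons map_append)

lemma prefix_mono_map: "prefix_mono g \<Longrightarrow> prefix_mono (\<lambda>w. g (map f w))"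
  by (simp add: prefix_mono_def)

lemma map_add_glue: "map ((+) k) (glue y \<alpha> w) = glue (k + y) \<alpha> w"
  by (simp add: glue_def add.assoc o_def)

lemma sum_avoiders_eq_mean: "(\<Sum>xs\<in>avoiders n. g xs) = ennreal (catalan n) * avoider_mean n g"
proof -
  have "ennreal (catalan n) * ennreal (1 / catalan n) = 1"
    using catalan_pos[of n] by (subst ennreal_mult[symmetric]) (auto simp: less_imp_le)
  then show ?thesis
    by (simp add: avoider_mean_def mult.assoc[symmetric])
qed

text \<open>A cut of a permutation of size \<open>Suc n\<close> with one part prescribed, of length
  \<open>j\<close>, has probability \<open>catalan (n - j) / catalan (Suc n)\<close>; the two
  indices are \<open>Suc j\<close> steps of ratio at most 4 apart.\<close>

lemma weight_le_catalan_ratio: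
  assumes "j \<le> n"
  shows "ennreal (1 / 4 ^ Suc j) * x \<le> ennreal (1 / catalan (Suc n)) * (ennreal (catalan (n - j)) * x)"
proof -
  have "catalan (Suc n) \<le> 4 ^ Suc j * catalan (n - j)"
    using catalan_add_le[of "n - j" "Suc j"] assms by simp
  then have "1 / 4 ^ Suc j \<le> 1 / catalan (Suc n) * catalan (n - j)"
    using catalan_pos[of "Suc n"] by (simp add: field_simps)
  then have "ennreal (1 / 4 ^ Suc j) \<le> ennreal (1 / catalan (Suc n)) * ennreal (catalan (n - j))"
    using catalan_pos[of "Suc n"] catalan_pos[of "n - j"]
    by (subst ennreal_mult[symmetric]) (auto simp: less_imp_le intro!: ennreal_leI)
  then show ?thesis
    by (subst mult.assoc[symmetric]) (rule mult_right_mono, auto)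
qed

text \<open>\<open>A\<close> comes from the cuts with at most \<open>N\<close> entries before the value 1, \<open>B\<close> from those with at
  most \<open>N\<close> entries after it; all other cuts are dropped.\<close>

lemma avoider_mean_step:
  assumes g: "prefix_mono g" and m: "2 * N + 2 \<le> m"
    and A: "\<And>n \<alpha>. N \<le> n \<Longrightarrow> A \<alpha> \<le> avoider_mean n (\<lambda>w. g (glue 1 \<alpha> w))"
    and B: "\<And>n. N \<le> n \<Longrightarrow> B \<le> avoider_mean n (\<lambda>w. g (map ((+) 1) w))"
  shows "(\<Sum>j\<le>N. \<Sum>\<alpha>\<in>avoiders j. ennreal (1 / 4 ^ Suc j) * (A \<alpha> + B)) \<le> avoider_mean m g"
proof -
  obtain n where n: "m = Suc n" using m by (cases m) auto
  let ?c = "ennreal (1 / catalan (Suc n))"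
  define G where "G j = (\<Sum>\<alpha>\<in>avoiders j. \<Sum>\<beta>\<in>avoiders (n - j). g (glue 1 \<alpha> \<beta>))" for j
  have left: "(\<Sum>\<alpha>\<in>avoiders j. ennreal (1 / 4 ^ Suc j) * A \<alpha>) \<le> ?c * G j" if "j \<le> N" for j
  proof -
    have "(\<Sum>\<alpha>\<in>avoiders j. ennreal (1 / 4 ^ Suc j) * A \<alpha>) \<le>
        (\<Sum>\<alpha>\<in>avoiders j. ?c * (ennreal (catalan (n - j)) * avoider_mean (n - j) (\<lambda>w. g (glue 1 \<alpha> w))))"
      using that m n
      by (intro sum_mono order_trans[OF weight_le_catalan_ratio[of j n]] mult_left_mono A) auto
    then show ?thesis
      by (simp only: G_def sum_avoiders_eq_mean[of _ "n - j"] sum_distrib_left)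
  qed
  have right: "(\<Sum>\<alpha>\<in>avoiders j. ennreal (1 / 4 ^ Suc j) * B) \<le> ?c * G (n - j)" if "j \<le> N" for j
  proof -
    have "(\<Sum>\<alpha>\<in>avoiders j. ennreal (1 / 4 ^ Suc j) * B) \<le>
        (\<Sum>\<beta>\<in>avoiders j. ?c * (ennreal (catalan (n - j)) * avoider_mean (n - j) (\<lambda>w. g (map ((+) 1) w))))"
      using that m n
      by (intro sum_mono order_trans[OF weight_le_catalan_ratio[of j n]] mult_left_mono B) auto
    also have "\<dots> = ?c * (\<Sum>\<beta>\<in>avoiders j. \<Sum>\<alpha>\<in>avoiders (n - j). g (map ((+) 1) \<alpha>))"
      by (simp only: sum_avoiders_eq_mean[of _ "n - j"] sum_distrib_left)
    \<comment> \<open>The small \<open>\<beta>\<close> is forgotten: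
      \<open>map ((+) 1) \<alpha>\<close> is a prefix of
      \<open>glue 1 \<alpha> \<beta>\<close>.\<close>
    also have "\<dots> \<le> ?c * (\<Sum>\<beta>\<in>avoiders j. \<Sum>\<alpha>\<in>avoiders (n - j). g (glue 1 \<alpha> \<beta>))"
      using g by (intro mult_left_mono sum_mono) (auto simp: prefix_mono_def glue_def)
    also have "\<dots> = ?c * G (n - j)"
      unfolding G_def using that m n by (subst sum.swap) simp
    finally show ?thesis .
  qed
  have inj: "inj_on (\<lambda>j. n - j) {..N}"
    using m n by (auto simp: inj_on_def)
  \<comment> \<open>\<open>m \<ge> 2 * N + 2\<close> means \<open>n \<ge> 2 * N + 1\<close>: the
    sizes \<open>j\<close> and \<open>n - j\<close> with \<open>j \<le> N\<close> never meet, and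
    the large part has at least \<open>N\<close> entries, as \<open>A\<close> and \<open>B\<close>
    require.\<close>
  have disj: "{..N} \<inter> (\<lambda>j. n - j) ` {..N} = {}"
    using m n by auto
  have "(\<Sum>j\<le>N. \<Sum>\<alpha>\<in>avoiders j. ennreal (1 / 4 ^ Suc j) * (A \<alpha> + B)) \<le>
      (\<Sum>j\<le>N. ?c * G j + ?c * G (n - j))"
    using left right by (intro sum_mono) (simp only: distrib_left sum.distrib add_mono atMost_iff)
  also have "\<dots> = ?c * ((\<Sum>j\<le>N. G j) + (\<Sum>j\<in>(\<lambda>j. n - j) ` {..N}. G j))"
    by (simp add: sum.distrib sum_distrib_left distrib_left sum.reindex[OF inj])
  also have "\<dots> = ?c * (\<Sum>j\<in>{..N} \<union> (\<lambda>j. n - j) ` {..N}. G j)"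
    using disj by (subst sum.union_disjoint) auto
  also have "\<dots> \<le> ?c * (\<Sum>j\<le>n. G j)"
    using m n by (intro mult_left_mono sum_mono2) auto
  also have "\<dots> = avoider_mean m g"
    by (simp only: avoider_mean_def n sum_avoiders_Suc G_def)
  finally show ?thesis .
qed

lemma UN_avoiders: "(\<Union>j\<le>N. avoiders j) = {\<alpha>. \<alpha> \<in> avoiders (length \<alpha>) \<and> length \<alpha> \<le> N}"
  by (auto simp: length_avoiders)

lemma sum_UN_avoiders:
  "(\<Sum>j\<le>N. \<Sum>\<alpha>\<in>avoiders j. h \<alpha>) = (\<Sum>\<alpha>\<in>(\<Union>j\<le>N. avoiders j). h \<alpha>)"
  by (rule sum.UNION_disjoint[symmetric]) (auto dest: length_avoiders)

text \<open>Monotone convergence along a diagonal: the truncation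
  \<open>length \<alpha> \<le> N\<close>, which makes the integral a finite sum, and the index of
  \<open>h\<close> grow together.\<close>

lemma nn_integral_avoider_weight_SUP:
  assumes "\<And>\<alpha>. incseq (\<lambda>N. h N \<alpha>)"
  shows "(\<integral>\<^sup>+\<alpha>. avoider_weight \<alpha> * (SUP N. h N \<alpha>) \<partial>count_space UNIV) =
    (SUP N. \<Sum>j\<le>N. \<Sum>\<alpha>\<in>avoiders j. ennreal (1 / 4 ^ Suc j) * h N \<alpha>)"
proof -
  define F where "F N \<alpha> = (if length \<alpha> \<le> N then avoider_weight \<alpha> * h N \<alpha> else 0)" for N \<alpha>
  have h: "h N \<alpha> \<le> h N' \<alpha>" if "N \<le> N'" for N N' \<alpha>
    using assms that by (simp add: incseq_def)
  have inc: "incseq F"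
    by (auto simp: incseq_def le_fun_def F_def intro!: mult_left_mono h)
  have "(SUP N. F N \<alpha>) = avoider_weight \<alpha> * (SUP N. h N \<alpha>)" for \<alpha>
  proof -
    have "(SUP N. F N \<alpha>) = (SUP N. avoider_weight \<alpha> * h N \<alpha>)"
    proof (intro antisym SUP_mono)
      fix N
      show "\<exists>m\<in>UNIV. F N \<alpha> \<le> avoider_weight \<alpha> * h m \<alpha>"
        by (auto simp: F_def)
      show "\<exists>m\<in>UNIV. avoider_weight \<alpha> * h N \<alpha> \<le> F m \<alpha>"
        \<comment> \<open>The index must reach \<open>length \<alpha>\<close> to pass the truncation
          in \<open>F\<close>.\<close>
        by (intro bexI[of _ "max N (length \<alpha>)"]) (auto simp: F_def intro!: mult_left_mono h)
    qed
    then show ?thesis by (simp add: SUP_mult_left_ennreal)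
  qed
  then have "(\<integral>\<^sup>+\<alpha>. avoider_weight \<alpha> * (SUP N. h N \<alpha>) \<partial>count_space UNIV) =
      (\<integral>\<^sup>+\<alpha>. (SUP N. F N \<alpha>) \<partial>count_space UNIV)"
    by simp
  also have "\<dots> = (SUP N. \<integral>\<^sup>+\<alpha>. F N \<alpha> \<partial>count_space UNIV)"
    by (rule nn_integral_monotone_convergence_SUP[OF inc]) auto
  also have "\<dots> = (SUP N. \<Sum>j\<le>N. \<Sum>\<alpha>\<in>avoiders j. ennreal (1 / 4 ^ Suc j) * h N \<alpha>)"
  proof (rule SUP_cong[OF refl])
    fix N
    have "(\<integral>\<^sup>+\<alpha>. F N \<alpha> \<partial>count_space UNIV) = (\<Sum>\<alpha>\<in>(\<Union>j\<le>N. avoiders j). F N \<alpha>)"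
    proof (rule nn_integral_count_space')
      show "finite (\<Union>j\<le>N. avoiders j)" by simp
    qed (auto simp: F_def avoider_weight_def UN_avoiders)
    also have "\<dots> = (\<Sum>j\<le>N. \<Sum>\<alpha>\<in>avoiders j. F N \<alpha>)"
      by (rule sum_UN_avoiders[symmetric])
    also have "\<dots> = (\<Sum>j\<le>N. \<Sum>\<alpha>\<in>avoiders j. ennreal (1 / 4 ^ Suc j) * h N \<alpha>)"
      by (intro sum.cong refl) (auto simp: F_def avoider_weight_eq length_avoiders)
    finally show "(\<integral>\<^sup>+\<alpha>. F N \<alpha> \<partial>count_space UNIV) =
        (\<Sum>j\<le>N. \<Sum>\<alpha>\<in>avoiders j. ennreal (1 / 4 ^ Suc j) * h N \<alpha>)" .
  qed
  finally show ?thesis .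
qed

text \<open>There are \<open>catalan j\<close> words of length \<open>j\<close>, each of weight
  \<open>1 / 4 ^ Suc j\<close>. The hypothesis says that the law of \<open>X\<close> has mass 1 and
  is later supplied by \<open>catalan_sums_1\<close>.\<close>

lemma nn_integral_avoider_weight:
  assumes "(\<lambda>k. catalan k / (2 * 4 ^ k)) sums 1"
  shows "(\<integral>\<^sup>+\<alpha>. avoider_weight \<alpha> \<partial>count_space UNIV) = ennreal (1 / 2)"
proof -
  have "(\<lambda>k. (1 / 2) * (catalan k / (2 * 4 ^ k))) sums ((1 / 2) * 1)"
    by (rule sums_mult[OF assms])
  then have sums: "(\<lambda>k. catalan k / 4 ^ Suc k) sums (1 / 2)"
    by (simp add: field_simps)
  have "(\<integral>\<^sup>+\<alpha>. avoider_weight \<alpha> \<partial>count_space UNIV) =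
      (SUP N. \<Sum>j\<le>N. \<Sum>\<alpha>\<in>avoiders j. ennreal (1 / 4 ^ Suc j))"
    using nn_integral_avoider_weight_SUP[of "\<lambda>_ _. 1"] by simp
  also have "(\<lambda>N. \<Sum>j\<le>N. \<Sum>\<alpha>\<in>avoiders j. ennreal (1 / 4 ^ Suc j)) =
      (\<lambda>N. \<Sum>j<Suc N. ennreal (catalan j / 4 ^ Suc j))"
    unfolding lessThan_Suc_atMost
    by (intro ext sum.cong refl)
      (simp add: card_avoiders ennreal_of_nat_eq_real_of_nat catalan_pos less_imp_le flip: ennreal_mult)
  also have "(SUP N. \<Sum>j<Suc N. ennreal (catalan j / 4 ^ Suc j)) = (SUP N. \<Sum>j<N. ennreal (catalan j / 4 ^ Suc j))"
  proof (intro antisym SUP_mono)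
    fix N show "\<exists>m\<in>UNIV. (\<Sum>j<N. ennreal (catalan j / 4 ^ Suc j)) \<le> (\<Sum>j<Suc m. ennreal (catalan j / 4 ^ Suc j))"
      by (intro bexI[of _ N] sum_mono2) auto
  qed blast
  also have "\<dots> = (\<Sum>j. ennreal (catalan j / 4 ^ Suc j))"
    by (rule suminf_eq_SUP[symmetric])
  also have "\<dots> = ennreal (1 / 2)"
    using sums by (intro suminf_ennreal_eq) (auto simp: catalan_pos less_imp_le)
  finally show ?thesis .
qed

text \<open>One cut for \<open>n\<close> tending to infinity: a small \<open>\<alpha>\<close> is
  kept and the procedure restarts behind it, while the small \<open>\<beta>\<close> have total
  weight one half and only raise the values by 1.\<close>

lemma avoider_liminf_step:
  assumes "(\<lambda>k. catalan k / (2 * 4 ^ k)) sums 1" and g: "prefix_mono g"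
  shows "(\<integral>\<^sup>+\<alpha>. avoider_weight \<alpha> * avoider_liminf (\<lambda>w. g (glue 1 \<alpha> w)) \<partial>count_space UNIV) +
    ennreal (1 / 2) * avoider_liminf (\<lambda>w. g (map ((+) 1) w)) \<le> avoider_liminf g"
proof -
  \<comment> \<open>Tail infima turn lower limits into increasing suprema and give the bounds,
    uniform in \<open>n \<ge> N\<close>, that \<open>avoider_mean_step\<close> takes as
    \<open>A\<close> and \<open>B\<close>.\<close>
  define I where "I g N = (INF n\<in>{N..}. avoider_mean n g)" for g N
  have lim: "avoider_liminf g = (SUP N. I g N)" for g
    by (simp add: avoider_liminf_def I_def liminf_SUP_INF)
  have inc: "incseq (I g)" for g
    unfolding I_def by (intro incseq_SucI INF_superset_mono) auto
  have I_le: "I g N \<le> avoider_mean n g" if "N \<le> n" for g n N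
    unfolding I_def using that by (auto intro: INF_lower)
  define h where "h N \<alpha> = I (\<lambda>w. g (glue 1 \<alpha> w)) N + I (\<lambda>w. g (map ((+) 1) w)) N" for N \<alpha>
  have "(\<integral>\<^sup>+\<alpha>. avoider_weight \<alpha> * avoider_liminf (\<lambda>w. g (glue 1 \<alpha> w)) \<partial>count_space UNIV) +
      ennreal (1 / 2) * avoider_liminf (\<lambda>w. g (map ((+) 1) w)) =
    (\<integral>\<^sup>+\<alpha>. avoider_weight \<alpha> * (avoider_liminf (\<lambda>w. g (glue 1 \<alpha> w)) +
      avoider_liminf (\<lambda>w. g (map ((+) 1) w))) \<partial>count_space UNIV)"
    by (simp only: distrib_left nn_integral_add measurable_count_space space_count_space UNIV_I
        nn_integral_multc nn_integral_avoider_weight[OF assms(1)] borel_measurable_count_space)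
  also have "\<dots> = (\<integral>\<^sup>+\<alpha>. avoider_weight \<alpha> * (SUP N. h N \<alpha>) \<partial>count_space UNIV)"
    unfolding lim h_def by (subst ennreal_SUP_add[OF inc inc, symmetric]) simp
  also have "\<dots> = (SUP N. \<Sum>j\<le>N. \<Sum>\<alpha>\<in>avoiders j. ennreal (1 / 4 ^ Suc j) * h N \<alpha>)"
  proof (rule nn_integral_avoider_weight_SUP)
    show "incseq (\<lambda>N. h N \<alpha>)" for \<alpha>
      using inc by (auto simp: h_def incseq_def intro!: add_mono)
  qed
  also have "\<dots> \<le> (SUP N. I g N)"
  proof (rule SUP_mono)
    fix N
    have "(\<Sum>j\<le>N. \<Sum>\<alpha>\<in>avoiders j. ennreal (1 / 4 ^ Suc j) * h N \<alpha>) \<le> I g (2 * N + 2)"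
      unfolding h_def I_def[of g "2 * N + 2"] by (intro INF_greatest avoider_mean_step g I_le) auto
    then show "\<exists>m\<in>UNIV. (\<Sum>j\<le>N. \<Sum>\<alpha>\<in>avoiders j. ennreal (1 / 4 ^ Suc j) * h N \<alpha>) \<le> I g m"
      by blast
  qed
  finally show ?thesis by (simp add: lim)
qed

text \<open>A pair \<open>(y, \<alpha>)\<close> encodes a value \<open>y\<close> of \<open>Y\<close> and a listing \<open>\<alpha>\<close> of \<open>\<Pi>\<close>, shifted to
  a permutation of \<open>{1..length \<alpha>}\<close>; the weight is the probability of that pair.\<close>

definition block_weight :: "nat \<times> nat list \<Rightarrow> ennreal" where
  "block_weight = (\<lambda>(y, \<alpha>). if y = 0 then 0 else ennreal ((1 / 2) ^ (y - 1)) * avoider_weight \<alpha>)"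

fun block_word :: "(nat \<times> nat list) list \<Rightarrow> nat list" where
  "block_word [] = []"
| "block_word ((y, \<alpha>) # zs) = glue y \<alpha> (block_word zs)"

text \<open>Iterates \<open>avoider_liminf_step\<close> on its second summand. In the summand
  \<open>y\<close>, exactly \<open>y\<close> cuts with small \<open>\<beta>\<close> precede the
  first one with small \<open>\<alpha>\<close>, whence \<open>Suc y\<close> as the value of
  \<open>Y\<close>; the last summand stands for \<open>K\<close> cuts with small
  \<open>\<beta>\<close> in a row.\<close>

lemma avoider_liminf_geometric:
  assumes "(\<lambda>k. catalan k / (2 * 4 ^ k)) sums 1" and g: "prefix_mono g"
  shows "(\<Sum>y<K. ennreal ((1 / 2) ^ y) *
      (\<integral>\<^sup>+\<alpha>. avoider_weight \<alpha> * avoider_liminf (\<lambda>w. g (glue (Suc y) \<alpha> w)) \<partial>count_space UNIV)) +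
    ennreal ((1 / 2) ^ K) * avoider_liminf (\<lambda>w. g (map ((+) K) w)) \<le> avoider_liminf g"
proof (induction K)
  case 0
  then show ?case by (simp add: map_idI)
next
  case (Suc K)
  let ?p = "ennreal ((1 / 2) ^ K)"
  let ?L = "\<integral>\<^sup>+\<alpha>. avoider_weight \<alpha> * avoider_liminf (\<lambda>w. g (glue (Suc K) \<alpha> w)) \<partial>count_space UNIV"
  have half: "ennreal ((1 / 2) ^ Suc K) = ?p * ennreal (1 / 2)"
    by (subst ennreal_mult[symmetric]) auto
  have comp: "(+) K \<circ> (+) (Suc 0) = (+) (Suc K)"
    by (simp add: fun_eq_iff)
  have "?L + ennreal (1 / 2) * avoider_liminf (\<lambda>w. g (map ((+) (Suc K)) w))
      \<le> avoider_liminf (\<lambda>w. g (map ((+) K) w))"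
    using avoider_liminf_step[OF assms(1) prefix_mono_map[OF g, of "(+) K"]]
    by (simp add: map_add_glue comp)
  then have "?p * (?L + ennreal (1 / 2) * avoider_liminf (\<lambda>w. g (map ((+) (Suc K)) w)))
      \<le> ?p * avoider_liminf (\<lambda>w. g (map ((+) K) w))"
    by (rule mult_left_mono) simp
  then show ?case
    unfolding half sum.lessThan_Suc mult.assoc add.assoc
    by (intro order_trans[OF add_left_mono Suc.IH]) (simp add: distrib_left mult.assoc)
qed

text \<open>\<open>avoider_liminf_geometric\<close> for all \<open>K\<close>, its nonnegative last
  summand dropped; the sum over \<open>y\<close> and the integral over \<open>\<alpha>\<close> merge
  into one over pairs.\<close>

lemma avoider_liminf_block:
  assumes "(\<lambda>k. catalan k / (2 * 4 ^ k)) sums 1" and g: "prefix_mono g"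
  shows "(\<integral>\<^sup>+z. block_weight z * avoider_liminf (\<lambda>w. g (glue (fst z) (snd z) w)) \<partial>count_space UNIV)
    \<le> avoider_liminf g"
proof -
  let ?F = "\<lambda>y. \<integral>\<^sup>+\<alpha>. avoider_weight \<alpha> * avoider_liminf (\<lambda>w. g (glue y \<alpha> w)) \<partial>count_space UNIV"
  have "(\<integral>\<^sup>+z. block_weight z * avoider_liminf (\<lambda>w. g (glue (fst z) (snd z) w)) \<partial>count_space UNIV)
     = (\<integral>\<^sup>+y. (\<integral>\<^sup>+\<alpha>. block_weight (y, \<alpha>) * avoider_liminf (\<lambda>w. g (glue y \<alpha> w)) \<partial>count_space UNIV)
          \<partial>count_space UNIV)"
    by (subst nn_integral_fst_count_space[symmetric]) simp
  also have "\<dots> = (\<Sum>y. if y = 0 then 0 else ennreal ((1 / 2) ^ (y - 1)) * ?F y)"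
    unfolding nn_integral_count_space_nat
    by (intro suminf_cong) (simp add: block_weight_def mult.assoc nn_integral_cmult)
  also have "\<dots> = (SUP n. \<Sum>y<n. if y = 0 then 0 else ennreal ((1 / 2) ^ (y - 1)) * ?F y)"
    by (rule suminf_eq_SUP)
  also have "\<dots> \<le> avoider_liminf g"
  proof (rule SUP_least)
    fix n
    show "(\<Sum>y<n. if y = 0 then 0 else ennreal ((1 / 2) ^ (y - 1)) * ?F y) \<le> avoider_liminf g"
    proof (cases n)
      case (Suc K)
      have "(\<Sum>y<n. if y = 0 then 0 else ennreal ((1 / 2) ^ (y - 1)) * ?F y) =
          (\<Sum>y<K. ennreal ((1 / 2) ^ y) * ?F (Suc y))"
        unfolding Suc sum.lessThan_Suc_shift by simp
      also have "\<dots> \<le> avoider_liminf g"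
        by (rule order_trans[OF _ avoider_liminf_geometric[OF assms, of K]]) simp
      finally show ?thesis .
    qed simp
  qed
  finally show ?thesis .
qed

lemma avoider_liminf_ge_Nil:
  assumes "prefix_mono g"
  shows "g [] \<le> avoider_liminf g"
  unfolding avoider_liminf_def
proof (intro Liminf_bounded always_eventually allI)
  fix n
  have "g [] = ennreal (1 / catalan n) * (ennreal (catalan n) * g [])"
    using catalan_pos[of n]
    by (subst mult.assoc[symmetric], subst ennreal_mult[symmetric]) (auto simp: less_imp_le)
  also have "\<dots> = ennreal (1 / catalan n) * (\<Sum>xs\<in>avoiders n. g [])"
    by (simp add: card_avoiders ennreal_of_nat_eq_real_of_nat)
  also have "\<dots> \<le> avoider_mean n g"
    unfolding avoider_mean_def
    using assms unfolding prefix_mono_def by (intro mult_left_mono sum_mono) (metis append_Nil, simp)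
  finally show "g [] \<le> avoider_mean n g" .
qed

lemma nn_integral_lists_Suc:
  fixes F :: "'a list \<Rightarrow> ennreal"
  shows "(\<integral>\<^sup>+zs. F zs \<partial>count_space {zs. length zs = Suc k}) =
    (\<integral>\<^sup>+z. (\<integral>\<^sup>+zs. F (z # zs) \<partial>count_space {zs. length zs = k}) \<partial>count_space UNIV)"
proof -
  let ?A = "UNIV \<times> {zs :: 'a list. length zs = k}"
  have bij: "bij_betw (\<lambda>(z, zs). z # zs) ?A {zs. length zs = Suc k}"
    by (auto simp: bij_betw_def inj_on_def length_Suc_conv image_iff)
  have "(\<integral>\<^sup>+zs. F zs \<partial>count_space {zs. length zs = Suc k}) =
      (\<integral>\<^sup>+x. F (fst x # snd x) \<partial>count_space ?A)"
    by (subst nn_integral_bij_count_space[OF bij, symmetric]) (simp add: split_def)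
  also have "\<dots> = (\<integral>\<^sup>+x. F (fst x # snd x) * indicator ?A x \<partial>count_space UNIV)"
    by (rule nn_integral_count_space_indicator) simp
  also have "\<dots> = (\<integral>\<^sup>+z. (\<integral>\<^sup>+zs. F (z # zs) * indicator {zs. length zs = k} zs \<partial>count_space UNIV)
      \<partial>count_space UNIV)"
    by (subst nn_integral_fst_count_space[symmetric]) (simp add: indicator_def)
  also have "\<dots> = (\<integral>\<^sup>+z. (\<integral>\<^sup>+zs. F (z # zs) \<partial>count_space {zs. length zs = k}) \<partial>count_space UNIV)"
    by (subst nn_integral_count_space_indicator[symmetric]) simp_all
  finally show ?thesis .
qed

text \<open>The first block is peeled off by \<open>avoider_liminf_block\<close>; the induction
  hypothesis applies to \<open>g (glue y \<alpha> w)\<close> as a functional of the remaining word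
  \<open>w\<close>, which is again monotone by \<open>prefix_mono_glue\<close>.\<close>

lemma avoider_liminf_ge_blocks:
  assumes "(\<lambda>k. catalan k / (2 * 4 ^ k)) sums 1" and "prefix_mono g"
  shows "(\<integral>\<^sup>+zs. prod_list (map block_weight zs) * g (block_word zs) \<partial>count_space {zs. length zs = k})
    \<le> avoider_liminf g"
  using assms(2)
proof (induction k arbitrary: g)
  case 0
  then show ?case
    by (simp add: nn_integral_count_space_finite avoider_liminf_ge_Nil)
next
  case (Suc k)
  have "(\<integral>\<^sup>+zs. prod_list (map block_weight zs) * g (block_word zs) \<partial>count_space {zs. length zs = Suc k}) =
    (\<integral>\<^sup>+z. block_weight z * (\<integral>\<^sup>+zs. prod_list (map block_weight zs) *
      g (glue (fst z) (snd z) (block_word zs)) \<partial>count_space {zs. length zs = k}) \<partial>count_space UNIV)"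
    unfolding nn_integral_lists_Suc
    by (intro nn_integral_cong) (auto simp: mult.assoc nn_integral_cmult split: prod.split)
  also have "\<dots> \<le> (\<integral>\<^sup>+z. block_weight z * avoider_liminf (\<lambda>w. g (glue (fst z) (snd z) w)) \<partial>count_space UNIV)"
    using Suc by (intro nn_integral_mono mult_left_mono Suc.IH prefix_mono_glue) auto
  also have "\<dots> \<le> avoider_liminf g"
    by (rule avoider_liminf_block[OF assms(1) Suc.prems])
  finally show ?case .
qed

section \<open>Weak convergence\<close>

lemma openin_subset_Pow: "{U. openin T U} \<subseteq> Pow (topspace T)"
  using openin_subset by auto

lemma space_borel_of_top: "space (borel_of_top T) = topspace T"
  by (simp add: borel_of_top_def openin_subset_Pow)

lemma sets_borel_of_top: "sets (borel_of_top T) = sigma_sets (topspace T) {U. openin T U}"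
  by (simp add: borel_of_top_def openin_subset_Pow)

lemma continuous_map_borel_measurable:
  fixes f :: "'a \<Rightarrow> real"
  assumes "continuous_map T euclideanreal f"
  shows "f \<in> borel_measurable (borel_of_top T)"
proof (rule borel_measurableI)
  fix S :: "real set" assume "open S"
  then have "openin T {x \<in> topspace T. f x \<in> S}"
    using assms by (auto simp: continuous_map_def)
  moreover have "f -` S \<inter> space (borel_of_top T) = {x \<in> topspace T. f x \<in> S}"
    by (auto simp: space_borel_of_top)
  ultimately show "f -` S \<inter> space (borel_of_top T) \<in> sets (borel_of_top T)"
    by (auto simp: sets_borel_of_top)
qed

text \<open>Lower semicontinuity for all nonnegative test functions suffices: apply it to
  \<open>B + f\<close> and to \<open>B - f\<close>, where \<open>B\<close> bounds \<open>\<bar>f\<bar>\<close>.\<close>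

lemma weakly_convergesI:
  fixes T :: "'a topology"
  assumes \<mu>: "\<And>n. sets (\<mu> n) = sets (borel_of_top T)" "\<And>n. prob_space (\<mu> n)"
    and \<nu>: "sets \<nu> = sets (borel_of_top T)" "prob_space \<nu>"
    and lower: "\<And>f. continuous_map T euclideanreal f \<Longrightarrow> (\<And>x. x \<in> topspace T \<Longrightarrow> 0 \<le> f x) \<Longrightarrow>
      (\<integral>\<^sup>+x. ennreal (f x) \<partial>\<nu>) \<le> liminf (\<lambda>n. \<integral>\<^sup>+x. ennreal (f x) \<partial>\<mu> n)"
  shows "weakly_converges T \<mu> \<nu>"
  unfolding weakly_converges_def
proof (intro conjI allI impI \<mu> \<nu>)
  fix f :: "'a \<Rightarrow> real"
  assume f: "continuous_map T euclideanreal f \<and> bounded (f ` topspace T)"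
  then obtain B where B: "\<And>x. x \<in> topspace T \<Longrightarrow> \<bar>f x\<bar> \<le> B"
    by (auto simp: bounded_iff)
  have int: "integrable \<rho> g" and space: "space \<rho> = topspace T"
    if "sets \<rho> = sets (borel_of_top T)" "prob_space \<rho>" "continuous_map T euclideanreal g"
      "\<And>x. x \<in> topspace T \<Longrightarrow> \<bar>g x\<bar> \<le> C" for \<rho> g C
  proof -
    interpret \<rho>: prob_space \<rho> by fact
    show sp: "space \<rho> = topspace T"
      using sets_eq_imp_space_eq[OF that(1)] by (simp add: space_borel_of_top)
    have "g \<in> borel_measurable \<rho>"
      using continuous_map_borel_measurable[OF that(3)] measurable_cong_sets[OF that(1) refl] by blast
    then show "integrable \<rho> g"
      by (intro \<rho>.integrable_const_bound[where B = C]) (auto simp: sp that(4))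
  qed
  have ev: "\<forall>\<^sub>F n in sequentially. c < (\<integral>x. g x \<partial>\<mu> n)"
    if g: "continuous_map T euclideanreal g" "\<And>x. x \<in> topspace T \<Longrightarrow> 0 \<le> g x"
      "\<And>x. x \<in> topspace T \<Longrightarrow> \<bar>g x\<bar> \<le> C" and c: "c < (\<integral>x. g x \<partial>\<nu>)" for g c C
  proof -
    have eq: "(\<integral>\<^sup>+x. ennreal (g x) \<partial>\<rho>) = ennreal (\<integral>x. g x \<partial>\<rho>)" "(\<integral>x. g x \<partial>\<rho>) \<ge> 0"
      if "sets \<rho> = sets (borel_of_top T)" "prob_space \<rho>" for \<rho>
      using int[OF that g(1,3)] space[OF that g(1,3)] g(2)
      by (auto intro!: nn_integral_eq_integral Bochner_Integration.integral_nonneg)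
    have "ennreal (\<integral>x. g x \<partial>\<nu>) \<le> liminf (\<lambda>n. ennreal (\<integral>x. g x \<partial>\<mu> n))"
      using lower[OF g(1,2)] by (simp add: eq \<mu> \<nu>)
    moreover have "ennreal (max 0 c) < ennreal (\<integral>x. g x \<partial>\<nu>)" if "c \<ge> 0"
      using c that by (simp add: ennreal_lessI)
    ultimately have "ennreal (max 0 c) < liminf (\<lambda>n. ennreal (\<integral>x. g x \<partial>\<mu> n))" if "c \<ge> 0"
      using that by (metis less_le_trans)
    then have "\<forall>\<^sub>F n in sequentially. ennreal (max 0 c) < ennreal (\<integral>x. g x \<partial>\<mu> n)"
      if "c \<ge> 0" using that by (intro less_LiminfD)
    then have "\<forall>\<^sub>F n in sequentially. c < (\<integral>x. g x \<partial>\<mu> n)" if "c \<ge> 0"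
      using that by (auto elim!: eventually_mono simp: ennreal_less_iff)
    \<comment> \<open>\<open>ennreal\<close> truncates negative numbers at 0, so a negative bound is
      treated apart: every integral of the nonnegative \<open>g\<close> exceeds it.\<close>
    moreover have "\<forall>\<^sub>F n in sequentially. c < (\<integral>x. g x \<partial>\<mu> n)" if "c < 0"
      using eq(2)[OF \<mu>] that by (auto intro: always_eventually less_le_trans)
    ultimately show ?thesis by linarith
  qed
  have cont: "continuous_map T euclideanreal (\<lambda>x. B + f x)" "continuous_map T euclideanreal (\<lambda>x. B - f x)"
    using f by (auto intro!: continuous_intros)
  have bd: "0 \<le> B + f x" "\<bar>B + f x\<bar> \<le> 2 * B" "0 \<le> B - f x" "\<bar>B - f x\<bar> \<le> 2 * B" if "x \<in> topspace T" for x
    using B[OF that] by auto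
  have shift: "(\<integral>x. B + f x \<partial>\<rho>) = B + (\<integral>x. f x \<partial>\<rho>)" "(\<integral>x. B - f x \<partial>\<rho>) = B - (\<integral>x. f x \<partial>\<rho>)"
    if "sets \<rho> = sets (borel_of_top T)" "prob_space \<rho>" for \<rho>
  proof -
    interpret \<rho>: prob_space \<rho> by fact
    have "integrable \<rho> f" using int[OF that, of f B] f B by auto
    then show "(\<integral>x. B + f x \<partial>\<rho>) = B + (\<integral>x. f x \<partial>\<rho>)" "(\<integral>x. B - f x \<partial>\<rho>) = B - (\<integral>x. f x \<partial>\<rho>)"
      by (simp_all add: \<rho>.prob_space)
  qed
  show "(\<lambda>n. \<integral>x. f x \<partial>\<mu> n) \<longlonglongrightarrow> (\<integral>x. f x \<partial>\<nu>)"
  proof (rule order_tendstoI)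
    fix a assume "a < (\<integral>x. f x \<partial>\<nu>)"
    then have "B + a < (\<integral>x. B + f x \<partial>\<nu>)" by (simp add: shift \<nu>)
    from ev[OF cont(1) bd(1,2) this] show "\<forall>\<^sub>F n in sequentially. a < (\<integral>x. f x \<partial>\<mu> n)"
      by (simp add: shift \<mu>)
  next
    fix a assume "(\<integral>x. f x \<partial>\<nu>) < a"
    then have "B - a < (\<integral>x. B - f x \<partial>\<nu>)" by (simp add: shift \<nu>)
    from ev[OF cont(2) bd(3,4) this] show "\<forall>\<^sub>F n in sequentially. (\<integral>x. f x \<partial>\<mu> n) < a"
      by (simp add: shift \<mu>)
  qed
qed

section \<open>Cylinders and the metric topology\<close>

definition cylinder :: "nat list \<Rightarrow> (nat \<Rightarrow> enat) set" where
  "cylinder w = {\<sigma> \<in> S_NNstar. \<forall>i<length w. \<sigma> (Suc i) = enat (w ! i)}"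

lemma cylinder_append: "cylinder (u @ v) \<subseteq> cylinder u"
  by (auto simp: cylinder_def nth_append)

lemma topspace_top_S [simp]: "topspace top_S = S_NNstar"
  by (simp add: top_S_def)

text \<open>Beyond the first \<open>m\<close> coordinates each distance is at most 2, and the
  weights there add up to \<open>(1 / 2) ^ m\<close>.\<close>

lemma dist_S_le:
  assumes "\<forall>i\<in>{1..m}. \<rho> i = \<sigma> i"
  shows "dist_S \<sigma> \<rho> \<le> 2 * (1 / 2) ^ m"
proof -
  have "dist_S \<sigma> \<rho> = (\<Sum>\<^sub>\<infinity>i\<in>{Suc m..}. (1 / 2) ^ i * dist_Nstar (\<sigma> i) (\<rho> i))"
    unfolding dist_S_def using assms
    by (intro infsum_cong_neutral) (auto simp: dist_Nstar_eq)
  also have "\<dots> \<le> (\<Sum>\<^sub>\<infinity>i\<in>{Suc m..}. (1 / 2) ^ i * 2)"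
  proof (rule infsum_mono)
    show "(\<lambda>i. (1 / 2 :: real) ^ i * dist_Nstar (\<sigma> i) (\<rho> i)) summable_on {Suc m..}"
      by (rule summable_on_subset_banach[OF dist_S_summable]) auto
    show "(\<lambda>i. (1 / 2 :: real) ^ i * 2) summable_on {Suc m..}"
      by (intro summable_on_cmult_left has_sum_imp_summable[OF has_sum_geometric])
  qed (auto simp: dist_Nstar_le)
  also have "\<dots> = 2 * (1 / 2) ^ m"
    by (subst infsum_cmult_left') (simp add: infsumI[OF has_sum_geometric])
  finally show ?thesis .
qed

lemma openin_top_S_imp_agree:
  assumes "openin top_S U" "\<sigma> \<in> U"
  obtains m where "\<And>\<rho>. \<rho> \<in> S_NNstar \<Longrightarrow> \<forall>i\<in>{1..m}. \<rho> i = \<sigma> i \<Longrightarrow> \<rho> \<in> U"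
proof -
  obtain r where r: "r > 0" "S_space.mball \<sigma> r \<subseteq> U" and U: "U \<subseteq> S_NNstar"
    using assms by (auto simp: top_S_def S_space.openin_mtopology)
  obtain m where m: "(1 / 2 :: real) ^ m < r / 2"
    using real_arch_pow_inv[of "r / 2" "1 / 2"] r by auto
  have "\<rho> \<in> U" if "\<rho> \<in> S_NNstar" "\<forall>i\<in>{1..m}. \<rho> i = \<sigma> i" for \<rho>
  proof -
    have "dist_S \<sigma> \<rho> < r"
      using dist_S_le[OF that(2)] m by simp
    then have "\<rho> \<in> S_space.mball \<sigma> r"
      using that assms(2) U by (auto simp: S_space.in_mball)
    then show ?thesis using r by auto
  qed
  then show ?thesis using that by blast
qed

text \<open>The form in which openness is used later: membership of \<open>\<sigma>\<close> in an
  open set is already visible from a long enough prefix \<open>W k\<close>.\<close>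

lemma openin_top_S_imp_cylinder:
  assumes "openin top_S U" "\<sigma> \<in> U" "\<And>k. k \<le> length (W k)" "\<And>k. \<sigma> \<in> cylinder (W k)"
  obtains k where "cylinder (W k) \<subseteq> U"
proof -
  obtain m where m: "\<And>\<rho>. \<rho> \<in> S_NNstar \<Longrightarrow> \<forall>i\<in>{1..m}. \<rho> i = \<sigma> i \<Longrightarrow> \<rho> \<in> U"
    using openin_top_S_imp_agree[OF assms(1,2)] by blast
  have "\<rho> \<in> U" if "\<rho> \<in> cylinder (W m)" for \<rho>
  proof (rule m)
    show "\<rho> \<in> S_NNstar" using that by (simp add: cylinder_def)
    show "\<forall>i\<in>{1..m}. \<rho> i = \<sigma> i"
    proof
      fix i assume "i \<in> {1..m}"
      then obtain i' where "i = Suc i'" "i' < length (W m)"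
        using assms(3)[of m] by (cases i) auto
      then show "\<rho> i = \<sigma> i"
        using that assms(4)[of m] by (simp add: cylinder_def)
    qed
  qed
  then show ?thesis using that by blast
qed

section \<open>From words to the measures on the sequence space\<close>

lemma embed_perm_mem:
  assumes "p permutes {1..n}"
  shows "embed_perm p \<in> S_NNstar"
proof -
  have "p i \<ge> 1" if "i \<ge> 1" for i
    using permutes_in_image[OF assms, of i] permutes_not_in[OF assms, of i] that
    by (metis atLeastAtMost_iff)
  moreover have "inj_on (\<lambda>i. enat (p i)) A" for A
    using permutes_inj[OF assms] by (auto simp: inj_on_def inj_def)
  then have "inj_on (embed_perm p) {i \<in> {1..}. embed_perm p i \<noteq> \<infinity>}"
    by (auto simp: inj_on_def embed_perm_def)
  ultimately show ?thesis
    by (auto simp: S_NNstar_def embed_perm_def one_enat_def)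
qed

lemma bij_betw_avoiding_perms:
  "bij_betw (\<lambda>p. map p [1..<Suc n]) (avoiding_perms n [3, 1, 2]) (avoiders n)"
  unfolding bij_betw_def
proof
  have set: "set (map p [1..<Suc n]) = p ` {1..n}" for p :: "nat \<Rightarrow> nat"
    by (simp only: set_map set_upt atLeastLessThanSuc_atLeastAtMost)
  show "inj_on (\<lambda>p. map p [1..<Suc n]) (avoiding_perms n [3, 1, 2])"
  proof (rule inj_onI)
    fix p q assume pq: "p \<in> avoiding_perms n [3, 1, 2]" "q \<in> avoiding_perms n [3, 1, 2]"
      and eq: "map p [1..<Suc n] = map q [1..<Suc n]"
    from pq have perm: "p permutes {1..n}" "q permutes {1..n}"
      unfolding avoiding_perms_def by blast+
    have "\<forall>i\<in>{1..n}. p i = q i"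
      using eq unfolding map_eq_conv set_upt atLeastLessThanSuc_atLeastAtMost .
    moreover have "p i = q i" if "i \<notin> {1..n}" for i
      using perm[THEN permutes_not_in, OF that] by simp
    ultimately show "p = q" by blast
  qed
  show "(\<lambda>p. map p [1..<Suc n]) ` avoiding_perms n [3, 1, 2] = avoiders n"
  proof (intro equalityI subsetI)
    fix xs assume "xs \<in> (\<lambda>p. map p [1..<Suc n]) ` avoiding_perms n [3, 1, 2]"
    then obtain p where p: "p permutes {1..n}" "avoids312 xs" "xs = map p [1..<Suc n]"
      unfolding avoiding_perms_def avoids_312 by blast
    then have "set xs = {1..n}"
      by (simp only: set permutes_image)
    moreover have "distinct xs"
      using p permutes_inj_on[OF p(1)] by (simp add: distinct_map del: upt_Suc)
    ultimately show "xs \<in> avoiders n" using p by (simp add: avoiders_def)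
  next
    fix xs assume xs: "xs \<in> avoiders n"
    define p where "p i = (if i \<in> {1..n} then xs ! (i - 1) else i)" for i
    have map: "map p [1..<Suc n] = xs"
      by (rule nth_equalityI) (simp_all add: p_def length_avoiders[OF xs] del: upt_Suc)
    have "p ` {1..n} = {1..n}"
      using set[of p] xs unfolding map by (simp add: avoiders_def)
    moreover from this have "inj_on p {1..n}"
      by (intro eq_card_imp_inj_on) simp_all
    ultimately have "p permutes {1..n}"
      by (intro bij_imp_permutes) (simp_all only: bij_betw_def p_def if_False simp_thms)
    moreover have "avoids xs [3, 1, 2]"
      using xs unfolding avoids_312 by (simp add: avoiders_def)
    ultimately show "xs \<in> (\<lambda>p. map p [1..<Suc n]) ` avoiding_perms n [3, 1, 2]"
      unfolding avoiding_perms_def using map by (intro image_eqI[of _ _ p]) (simp_all only: mem_Collect_eq)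
  qed
qed

lemma finite_avoiding_perms: "finite (avoiding_perms n [3, 1, 2])"
  using bij_betw_finite[OF bij_betw_avoiding_perms] by simp

lemma avoiding_perms_nonempty: "avoiding_perms n [3, 1, 2] \<noteq> {}"
  using bij_betw_imp_surj_on[OF bij_betw_avoiding_perms[of n]] avoiders_nonempty[of n]
  by (metis image_empty)

lemma measurable_embed_perm:
  "embed_perm \<in> uniform_count_measure (avoiding_perms n \<tau>) \<rightarrow>\<^sub>M borel_of_top top_S"
  by (auto simp: measurable_def space_uniform_count_measure sets_uniform_count_measure
      space_borel_of_top avoiding_perms_def intro: embed_perm_mem)

text \<open>The one-line word of a permutation is a prefix of its embedding, so a word functional
  lying below \<open>F\<close> on cylinders can be compared with \<open>F\<close> permutation by
  permutation.\<close>

lemma avoider_mean_le_nn_integral_mu: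
  assumes "F \<in> borel_measurable (borel_of_top top_S)"
    and "\<And>w \<sigma>. \<sigma> \<in> cylinder w \<Longrightarrow> g w \<le> F \<sigma>"
  shows "avoider_mean n g \<le> (\<integral>\<^sup>+\<sigma>. F \<sigma> \<partial>mu [3, 1, 2] n)"
proof -
  let ?A = "avoiding_perms n [3, 1, 2]"
  have card: "real (card ?A) = catalan n"
    using bij_betw_same_card[OF bij_betw_avoiding_perms[of n]] card_avoiders[of n] by simp
  have "(\<Sum>xs\<in>avoiders n. g xs) = (\<Sum>p\<in>?A. g (map p [1..<Suc n]))"
    by (rule sum.reindex_bij_betw[OF bij_betw_avoiding_perms, symmetric])
  also have "\<dots> \<le> (\<Sum>p\<in>?A. F (embed_perm p))"
  proof (intro sum_mono assms(2))
    fix p assume "p \<in> ?A"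
    then show "embed_perm p \<in> cylinder (map p [1..<Suc n])"
      using embed_perm_mem[of p n]
      by (auto simp: cylinder_def avoiding_perms_def embed_perm_def simp del: upt_Suc)
  qed
  finally have "avoider_mean n g \<le> ennreal (1 / catalan n) * (\<Sum>p\<in>?A. F (embed_perm p))"
    unfolding avoider_mean_def by (rule mult_left_mono) simp
  also have "\<dots> = (\<integral>\<^sup>+p. F (embed_perm p) \<partial>uniform_count_measure ?A)"
    unfolding uniform_count_measure_def
    by (subst nn_integral_point_measure_finite[OF finite_avoiding_perms])
      (simp only: card sum_distrib_left)
  also have "\<dots> = (\<integral>\<^sup>+\<sigma>. F \<sigma> \<partial>mu [3, 1, 2] n)"
    unfolding mu_def by (subst nn_integral_distr[OF measurable_embed_perm]) (use assms(1) in simp_all)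
  finally show ?thesis .
qed

text \<open>Separates topology from combinatorics: \<open>L\<close> is known only through its
  growing random prefixes \<open>W k\<close>, and \<open>dom\<close> is the only link between their
  law and the uniform measures.\<close>

lemma weak_convergence_if_prefix_dominated:
  fixes M :: "'a measure" and W :: "nat \<Rightarrow> 'a \<Rightarrow> nat list"
  assumes M: "prob_space M"
    and W: "\<And>k. W k \<in> M \<rightarrow>\<^sub>M count_space UNIV"
    and len: "\<And>k \<omega>. \<omega> \<in> space M \<Longrightarrow> k \<le> length (W k \<omega>)"
    and Suc: "\<And>k \<omega>. \<omega> \<in> space M \<Longrightarrow> \<exists>v. W (Suc k) \<omega> = W k \<omega> @ v"
    and cyl: "\<And>k \<omega>. \<omega> \<in> space M \<Longrightarrow> L \<omega> \<in> cylinder (W k \<omega>)"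
    and dom: "\<And>k g. prefix_mono g \<Longrightarrow> (\<integral>\<^sup>+\<omega>. g (W k \<omega>) \<partial>M) \<le> avoider_liminf g"
  shows "L \<in> M \<rightarrow>\<^sub>M borel_of_top top_S"
    and "weakly_converges top_S (mu [3, 1, 2]) (distr M (borel_of_top top_S) L)"
proof -
  interpret prob_space M by fact
  show L: "L \<in> M \<rightarrow>\<^sub>M borel_of_top top_S"
    unfolding borel_of_top_def
  proof (rule measurable_measure_of[OF openin_subset_Pow])
    show "L \<in> space M \<rightarrow> topspace top_S"
      using cyl by (auto simp: cylinder_def)
    fix U assume U: "U \<in> {U. openin top_S U}"
    \<comment> \<open>Openness is decided by prefixes, so the preimage is a countable union of
      events about the discrete variables \<open>W k\<close>.\<close>
    have "L -` U \<inter> space M = (\<Union>k. W k -` {w. cylinder w \<subseteq> U} \<inter> space M)"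
    proof (intro equalityI subsetI)
      fix \<omega> assume \<omega>: "\<omega> \<in> L -` U \<inter> space M"
      then obtain k where "cylinder (W k \<omega>) \<subseteq> U"
        using openin_top_S_imp_cylinder[of U "L \<omega>" "\<lambda>k. W k \<omega>"] U len cyl by auto
      with \<omega> show "\<omega> \<in> (\<Union>k. W k -` {w. cylinder w \<subseteq> U} \<inter> space M)" by auto
    next
      fix \<omega> assume "\<omega> \<in> (\<Union>k. W k -` {w. cylinder w \<subseteq> U} \<inter> space M)"
      then show "\<omega> \<in> L -` U \<inter> space M" using cyl by auto
    qed
    also have "\<dots> \<in> sets M"
    proof (rule sets.countable_UN, rule image_subsetI)
      show "W k -` {w. cylinder w \<subseteq> U} \<inter> space M \<in> sets M" for k
        by (rule measurable_sets[OF W]) simp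
    qed
    finally show "L -` U \<inter> space M \<in> sets M" .
  qed
  show "weakly_converges top_S (mu [3, 1, 2]) (distr M (borel_of_top top_S) L)"
  proof (rule weakly_convergesI)
    show "prob_space (mu [3, 1, 2] n)" for n
      unfolding mu_def
      by (intro prob_space.prob_space_distr prob_space_uniform_count_measure
          finite_avoiding_perms avoiding_perms_nonempty measurable_embed_perm)
    show "prob_space (distr M (borel_of_top top_S) L)"
      by (rule prob_space_distr[OF L])
    fix f :: "(nat \<Rightarrow> enat) \<Rightarrow> real"
    assume f: "continuous_map top_S euclideanreal f"
    have meas: "f \<in> borel_measurable (borel_of_top top_S)"
      by (rule continuous_map_borel_measurable[OF f])
    define H where "H w = (INF \<sigma>\<in>cylinder w. ennreal (f \<sigma>))" for w
    have H: "prefix_mono H"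
      unfolding prefix_mono_def H_def using cylinder_append by (auto intro: INF_superset_mono)
    \<comment> \<open>Lower semicontinuity at \<open>L \<omega>\<close>: the open set where
      \<open>f\<close> exceeds \<open>r\<close> contains the cylinder of some prefix, and on it the
      infimum \<open>H\<close> is at least \<open>r\<close>.\<close>
    have "ennreal (f (L \<omega>)) \<le> (SUP k. H (W k \<omega>))" if \<omega>: "\<omega> \<in> space M" for \<omega>
    proof (rule dense_le)
      fix c assume c: "c < ennreal (f (L \<omega>))"
      then have "c < top" by (metis ennreal_less_top less_trans)
      then obtain r where r: "r \<ge> 0" "c = ennreal r"
        by (cases c) auto
      let ?U = "{\<sigma> \<in> topspace top_S. f \<sigma> \<in> {r<..}}"
      have "openin top_S ?U"
        by (rule openin_continuous_map_preimage[OF f]) simp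
      moreover have "L \<omega> \<in> ?U"
        using c r cyl[OF \<omega>, of 0] by (auto simp: cylinder_def ennreal_less_iff)
      ultimately obtain k where "cylinder (W k \<omega>) \<subseteq> ?U"
        using openin_top_S_imp_cylinder[of ?U "L \<omega>" "\<lambda>k. W k \<omega>"] len[OF \<omega>] cyl[OF \<omega>] by blast
      then have "c \<le> H (W k \<omega>)"
        unfolding H_def r by (intro INF_greatest ennreal_leI) auto
      then show "c \<le> (SUP k. H (W k \<omega>))"
        by (rule order_trans) (rule SUP_upper, simp)
    qed
    then have "(\<integral>\<^sup>+\<omega>. ennreal (f (L \<omega>)) \<partial>M) \<le> (\<integral>\<^sup>+\<omega>. (SUP k. H (W k \<omega>)) \<partial>M)"
      by (rule nn_integral_mono)
    also have "\<dots> = (SUP k. \<integral>\<^sup>+\<omega>. H (W k \<omega>) \<partial>M)"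
    proof (rule nn_integral_monotone_convergence_SUP_AE)
      show "AE \<omega> in M. H (W k \<omega>) \<le> H (W (Suc k) \<omega>)" for k
        using Suc H unfolding prefix_mono_def by (intro AE_I2) metis
      show "(\<lambda>\<omega>. H (W k \<omega>)) \<in> borel_measurable M" for k
        by (rule measurable_compose[OF W]) simp
    qed
    also have "\<dots> \<le> avoider_liminf H"
      by (intro SUP_least dom H)
    also have "\<dots> \<le> liminf (\<lambda>n. \<integral>\<^sup>+\<sigma>. ennreal (f \<sigma>) \<partial>mu [3, 1, 2] n)"
      unfolding avoider_liminf_def
      by (intro Liminf_mono always_eventually allI avoider_mean_le_nn_integral_mu)
        (use meas in \<open>auto simp: H_def intro: INF_lower\<close>)
    finally show "(\<integral>\<^sup>+\<sigma>. ennreal (f \<sigma>) \<partial>distr M (borel_of_top top_S) L) \<le>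
        liminf (\<lambda>n. \<integral>\<^sup>+\<sigma>. ennreal (f \<sigma>) \<partial>mu [3, 1, 2] n)"
      using meas by (subst nn_integral_distr[OF L]) auto
  qed (auto simp: mu_def)
qed

section \<open>The limiting sequence\<close>

text \<open>The sum of the totals of \<open>Y\<close> and of \<open>X\<close> after the blocks
  \<open>zs\<close>, that is, the shift applied to everything that follows them.\<close>

definition total_span :: "(nat \<times> nat list) list \<Rightarrow> nat" where
  "total_span zs = (\<Sum>(y, \<alpha>)\<leftarrow>zs. y + length \<alpha>)"

definition valid_block :: "nat \<times> nat list \<Rightarrow> bool" where
  "valid_block = (\<lambda>(y, \<alpha>). 1 \<le> y \<and> \<alpha> \<in> avoiders (length \<alpha>))"

text \<open>The number \<open>T^Y_j + T^X_(j-1)\<close> of the limit, which closes block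
  \<open>j\<close>. Blocks are counted from 1 and list entries from 0, hence the index
  \<open>j - 1\<close>.\<close>

definition block_start :: "(nat \<times> nat list) list \<Rightarrow> nat \<Rightarrow> nat" where
  "block_start zs j = total_span (take (j - 1) zs) + fst (zs ! (j - 1))"

definition block_range :: "(nat \<times> nat list) list \<Rightarrow> nat \<Rightarrow> nat set" where
  "block_range zs j = {block_start zs j + 1..block_start zs j + length (snd (zs ! (j - 1)))}"

definition block_listing :: "(nat \<times> nat list) list \<Rightarrow> nat \<Rightarrow> nat list" where
  "block_listing zs j = map ((+) (block_start zs j)) (snd (zs ! (j - 1)))"

lemma total_span_simps [simp]:
  "total_span [] = 0" "total_span (z # zs) = fst z + length (snd z) + total_span zs"
  "total_span (us @ vs) = total_span us + total_span vs"
  by (simp_all add: total_span_def split_def)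

text \<open>\<open>block_word\<close> recurses from the front, as the lower bounds do, whereas the
  limit is read by appending blocks at the end; this reconciles the two.\<close>

lemma block_word_snoc:
  "block_word (zs @ [(y, \<alpha>)]) =
    block_word zs @ map ((+) (total_span zs + y)) \<alpha> @ [total_span zs + y]"
  by (induction zs rule: block_word.induct) (simp_all add: glue_def o_def add_ac)

lemma block_start_snoc:
  "j \<in> {1..length zs} \<Longrightarrow> block_start (zs @ [z]) j = block_start zs j"
  "block_start (zs @ [z]) (Suc (length zs)) = total_span zs + fst z"
  by (auto simp: block_start_def nth_append)

text \<open>Strictness comes from \<open>1 \<le> y\<close> in a valid block. It keeps nonempty
  blocks at different positions different, so that they index independent listings.\<close>

lemma block_start_less:
  assumes "\<forall>z\<in>set zs. valid_block z" "1 \<le> i" "i < j" "j \<le> length zs"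
  shows "block_start zs i + length (snd (zs ! (i - 1))) < block_start zs j"
proof -
  have "take (j - 1) zs = take (i - 1) zs @ take (j - i) (drop (i - 1) zs)"
    using assms take_add[of "i - 1" "j - i" zs] by simp
  also have "drop (i - 1) zs = zs ! (i - 1) # drop i zs"
    using assms Cons_nth_drop_Suc[of "i - 1" zs] by simp
  also have "take (j - i) (zs ! (i - 1) # drop i zs) = zs ! (i - 1) # take (j - i - 1) (drop i zs)"
    using assms by (cases "j - i") auto
  finally have "total_span (take (j - 1) zs) \<ge> block_start zs i + length (snd (zs ! (i - 1)))"
    by (simp add: block_start_def)
  moreover have "valid_block (zs ! (j - 1))"
    using assms by simp
  ultimately show ?thesis
    by (auto simp: block_start_def valid_block_def split: prod.splits)
qed

lemma valid_blockD:
  assumes "valid_block (y, \<alpha>)"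
  shows "1 \<le> y" "set \<alpha> = {1..length \<alpha>}" "distinct \<alpha>"
  using assms unfolding valid_block_def avoiders_def prod.case mem_Collect_eq by blast+

text \<open>The parts of \<open>glue y \<alpha> w\<close> do not overlap: \<open>y\<close> itself,
  then the values up to \<open>y + length \<alpha>\<close>, then those of \<open>w\<close> above
  that bound.\<close>

lemma block_word_props:
  assumes "\<forall>z\<in>set zs. valid_block z"
  shows "distinct (block_word zs)" "\<forall>v\<in>set (block_word zs). 1 \<le> v"
proof -
  have "distinct (block_word zs) \<and> (\<forall>v\<in>set (block_word zs). 1 \<le> v)"
    using assms
  proof (induction zs rule: block_word.induct)
    case (2 y \<alpha> zs)
    then have IH: "distinct (block_word zs)" "\<forall>v\<in>set (block_word zs). 1 \<le> v"
      and "valid_block (y, \<alpha>)"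
      by simp_all
    note y = valid_blockD(1)[OF this(3)] and \<alpha> = valid_blockD(2,3)[OF this(3)]
    have le: "\<forall>a\<in>set \<alpha>. 1 \<le> a \<and> a \<le> length \<alpha>"
      unfolding \<alpha>(1) by simp
    have "set (map ((+) y) \<alpha>) \<inter> set (map ((+) (y + length \<alpha>)) (block_word zs)) = {}"
    proof (rule ccontr)
      assume "set (map ((+) y) \<alpha>) \<inter> set (map ((+) (y + length \<alpha>)) (block_word zs)) \<noteq> {}"
      then obtain b where "length \<alpha> + b \<in> set \<alpha>" "b \<in> set (block_word zs)"
        by auto
      then show False using le IH(2) by fastforce
    qed
    moreover have "y \<notin> set (map ((+) y) \<alpha>)" "y \<notin> set (map ((+) (y + length \<alpha>)) (block_word zs))"
      using le IH(2) by fastforce+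
    ultimately have "distinct (block_word ((y, \<alpha>) # zs))"
      using IH \<alpha>(2) by (simp add: glue_def distinct_map)
    moreover have "\<forall>v\<in>set (block_word ((y, \<alpha>) # zs)). 1 \<le> v"
      using y by (auto simp: glue_def)
    ultimately show ?case ..
  qed simp
  then show "distinct (block_word zs)" "\<forall>v\<in>set (block_word zs). 1 \<le> v" by auto
qed

text \<open>The missing value lies just below the smallest entry of the block
  \<open>(y, \<alpha>)\<close>. Earlier blocks stay at or below \<open>total_span us\<close>, which
  is smaller because \<open>2 \<le> y\<close>, and later blocks lie above. This is why the limit is
  not onto.\<close>

lemma skipped_notin_block_word:
  assumes "\<forall>z\<in>set (us @ (y, \<alpha>) # vs). valid_block z" "2 \<le> y"
  shows "total_span us + y - 1 \<notin> set (block_word (us @ (y, \<alpha>) # vs))"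
  using assms(1)
proof (induction us)
  case Nil
  then show ?case using assms(2) by (auto simp: glue_def)
next
  case (Cons u us)
  obtain y' \<alpha>' where u: "u = (y', \<alpha>')" by force
  have "set \<alpha>' = {1..length \<alpha>'}"
    using Cons.prems u by (intro valid_blockD(2)[of y']) simp
  then have "\<forall>a\<in>set \<alpha>'. a \<le> length \<alpha>'" by auto
  moreover define v where "v = total_span us + y - 1"
  have "v \<notin> set (block_word (us @ (y, \<alpha>) # vs))"
    using Cons by (simp add: v_def)
  moreover have "1 \<le> v"
    using assms(2) by (simp add: v_def)
  ultimately have "y' + length \<alpha>' + v \<notin> set (glue y' \<alpha>' (block_word (us @ (y, \<alpha>) # vs)))"
    by (auto simp: glue_def)
  moreover have "total_span (u # us) + y - 1 = y' + length \<alpha>' + v"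
    using assms(2) by (simp add: u v_def)
  ultimately show ?case
    by (simp only: append_Cons u block_word.simps) simp
qed

section \<open>Prefixes of infinite concatenations; shifted listings\<close>

lemma flat_smap_fromN:
  assumes "\<And>j. a \<le> j \<Longrightarrow> Ls j \<noteq> []"
  shows "flat (smap Ls (fromN a)) = concat (map Ls [a..<a + k]) @- flat (smap Ls (fromN (a + k)))"
proof (induction k)
  case (Suc k)
  have "smap Ls (fromN (a + k)) = Ls (a + k) ## smap Ls (fromN (Suc (a + k)))"
    by (subst siterate.code) simp
  then have "flat (smap Ls (fromN (a + k))) = Ls (a + k) @- flat (smap Ls (fromN (Suc (a + k))))"
    using flat_Stream[OF assms[of "a + k"]] by simp
  with Suc show ?case by simp
qed simp

lemma infinite_concat_nth:
  assumes "\<And>j. 1 \<le> j \<Longrightarrow> Ls j \<noteq> []" "i < length (concat (map Ls [1..<Suc k]))"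
  shows "infinite_concat Ls (Suc i) = enat (concat (map Ls [1..<Suc k]) ! i)"
  using flat_smap_fromN[of 1 Ls k] assms by (simp add: infinite_concat_def shift_snth_less del: upt_Suc)

lemma avoiding_images_interval:
  "avoiding_images {a + 1..a + x} [3, 1, 2] = map ((+) a) ` avoiders x"
proof (intro equalityI subsetI)
  fix l assume l: "l \<in> avoiding_images {a + 1..a + x} [3, 1, 2]"
  then have set: "set l = {a + 1..a + x}" "distinct l" "avoids312 l"
    unfolding avoiding_images_312 by auto
  define \<alpha> where "\<alpha> = map (\<lambda>v. v - a) l"
  have map: "map ((+) a) \<alpha> = l"
    unfolding \<alpha>_def map_map by (rule map_idI) (auto simp: set)
  have "(+) a ` set \<alpha> = (+) a ` {1..x}"
    unfolding image_add_atLeastAtMost_1 using set(1) by (simp flip: map)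
  then have "set \<alpha> = {1..x}"
    by (subst (asm) inj_image_eq_iff) auto
  moreover have "distinct \<alpha>" "avoids312 \<alpha>"
    using set(2,3) avoids312_map_add[of a \<alpha>] unfolding map[symmetric] by (auto simp: distinct_map)
  ultimately show "l \<in> map ((+) a) ` avoiders x"
    using map by (auto simp: avoiders_def intro!: image_eqI[of _ _ \<alpha>])
next
  fix l assume "l \<in> map ((+) a) ` avoiders x"
  then show "l \<in> avoiding_images {a + 1..a + x} [3, 1, 2]"
    using image_add_atLeastAtMost_1[of a x]
    unfolding avoiding_images_312 by (auto simp: avoiders_def distinct_map)
qed

section \<open>Random blocks and pointwise properties of the limit\<close>

locale limit_setup = prob_space M for M :: "'a measure" +
  fixes X Y :: "nat \<Rightarrow> 'a \<Rightarrow> nat" and P :: "nat set \<Rightarrow> 'a \<Rightarrow> nat list"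
  assumes X_meas: "\<And>n. n \<ge> 1 \<Longrightarrow> X n \<in> M \<rightarrow>\<^sub>M count_space UNIV"
    and Y_meas: "\<And>n. n \<ge> 1 \<Longrightarrow> Y n \<in> M \<rightarrow>\<^sub>M count_space {1..}"
    and P_meas: "\<And>I. I \<in> blocks \<Longrightarrow> P I \<in> M \<rightarrow>\<^sub>M count_space (avoiding_images I [3, 1, 2])"
    and indep: "mutually_independent M X Y P"
    and X_dist: "\<And>n k. n \<ge> 1 \<Longrightarrow> \<P>(\<omega> in M. X n \<omega> = k) = catalan k / (2 * 4 ^ k)"
    and Y_dist: "\<And>n k. n \<ge> 1 \<Longrightarrow> k \<ge> 1 \<Longrightarrow> \<P>(\<omega> in M. Y n \<omega> = k) = (1 / 2) ^ k"
    and P_dist: "\<And>I. I \<in> blocks \<Longrightarrow>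
      distr M (count_space (avoiding_images I [3, 1, 2])) (P I) =
        uniform_count_measure (avoiding_images I [3, 1, 2])"
begin

definition offset :: "nat \<Rightarrow> 'a \<Rightarrow> nat" where
  "offset j \<omega> = partial_sum Y j \<omega> + partial_sum X (j - 1) \<omega>"

definition random_block :: "nat \<Rightarrow> 'a \<Rightarrow> nat set" where
  "random_block j \<omega> = {offset j \<omega> + 1..partial_sum Y j \<omega> + partial_sum X j \<omega>}"

text \<open>The listing of the random block is shifted down to an initial segment. In this form the
  codes have a product law, with factor \<open>block_weight\<close>, although the index of
  \<open>P\<close> depends on \<open>X\<close> and \<open>Y\<close>.\<close>

definition code :: "nat \<Rightarrow> 'a \<Rightarrow> nat \<times> nat list" where
  "code j \<omega> = (Y j \<omega>, map (\<lambda>v. v - offset j \<omega>) (P (random_block j \<omega>) \<omega>))"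

definition codes :: "nat \<Rightarrow> 'a \<Rightarrow> (nat \<times> nat list) list" where
  "codes k \<omega> = map (\<lambda>j. code j \<omega>) [1..<Suc k]"

lemma codes_0 [simp]: "codes 0 \<omega> = []"
  by (simp add: codes_def)

lemma codes_Suc: "codes (Suc k) \<omega> = codes k \<omega> @ [code (Suc k) \<omega>]"
  by (simp add: codes_def)

lemma length_codes [simp]: "length (codes k \<omega>) = k"
  by (simp add: codes_def del: upt_Suc)

lemma partial_sum_Suc: "partial_sum Z (Suc k) \<omega> = partial_sum Z k \<omega> + Z (Suc k) \<omega>"
  by (simp add: partial_sum_def)

lemma random_block_Suc:
  "random_block (Suc k) \<omega> = {offset (Suc k) \<omega> + 1..offset (Suc k) \<omega> + X (Suc k) \<omega>}"
  by (simp add: random_block_def offset_def partial_sum_Suc)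

lemma interval_in_blocks: "{a + 1..b} \<in> blocks"
  unfolding blocks_def by (rule CollectI, rule exI[of _ "a + 1"], rule exI[of _ b]) simp

lemma P_mem: "I \<in> blocks \<Longrightarrow> \<omega> \<in> space M \<Longrightarrow> P I \<omega> \<in> avoiding_images I [3, 1, 2]"
  using measurable_space[OF P_meas] by simp

lemma Y_ge_1: "n \<ge> 1 \<Longrightarrow> \<omega> \<in> space M \<Longrightarrow> 1 \<le> Y n \<omega>"
  using measurable_space[OF Y_meas] by fastforce

lemma P_interval:
  assumes "\<omega> \<in> space M"
  obtains \<alpha> where "\<alpha> \<in> avoiders x" "P {a + 1..a + x} \<omega> = map ((+) a) \<alpha>"
  using P_mem[OF interval_in_blocks assms, of a "a + x"] unfolding avoiding_images_interval by blast

lemma map_diff_add: "map (\<lambda>v. v - a) (map ((+) a) \<alpha>) = (\<alpha> :: nat list)"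
  unfolding map_map by (rule map_idI) simp

text \<open>Once \<open>T\<close>, \<open>y\<close> and the length of \<open>\<alpha>\<close> are
  fixed, the random index of \<open>P\<close> is a deterministic block; an event about a randomly
  indexed listing thus becomes one about the given families.\<close>

lemma code_Suc_eq_iff:
  assumes "\<omega> \<in> space M" and T: "T = partial_sum Y k \<omega> + partial_sum X k \<omega>"
  shows "code (Suc k) \<omega> = (y, \<alpha>) \<longleftrightarrow>
    X (Suc k) \<omega> = length \<alpha> \<and> Y (Suc k) \<omega> = y \<and>
    P {T + y + 1..T + y + length \<alpha>} \<omega> = map ((+) (T + y)) \<alpha>"
proof -
  have off: "offset (Suc k) \<omega> = T + Y (Suc k) \<omega>"
    by (simp add: offset_def partial_sum_Suc T)
  obtain \<beta> where \<beta>: "\<beta> \<in> avoiders (X (Suc k) \<omega>)"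
    "P {T + Y (Suc k) \<omega> + 1..T + Y (Suc k) \<omega> + X (Suc k) \<omega>} \<omega> = map ((+) (T + Y (Suc k) \<omega>)) \<beta>"
    using P_interval[OF assms(1)] by blast
  have code: "code (Suc k) \<omega> = (Y (Suc k) \<omega>, \<beta>)"
    unfolding code_def random_block_Suc off \<beta>(2) map_diff_add ..
  have inj: "map ((+) a) u = map ((+) a) v \<longleftrightarrow> u = v" for a :: nat and u v
    by (simp add: inj_map_eq_map)
  show ?thesis
    unfolding code using \<beta> length_avoiders[OF \<beta>(1)] inj by auto
qed

lemma valid_block_code:
  assumes "\<omega> \<in> space M"
  shows "valid_block (code (Suc k) \<omega>)"
proof -
  obtain \<beta> where \<beta>: "\<beta> \<in> avoiders (X (Suc k) \<omega>)"
    "P {offset (Suc k) \<omega> + 1..offset (Suc k) \<omega> + X (Suc k) \<omega>} \<omega> = map ((+) (offset (Suc k) \<omega>)) \<beta>"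
    using P_interval[OF assms] by blast
  have "code (Suc k) \<omega> = (Y (Suc k) \<omega>, \<beta>)"
    unfolding code_def random_block_Suc \<beta>(2) map_diff_add ..
  then show ?thesis
    using \<beta>(1) length_avoiders[OF \<beta>(1)] Y_ge_1[OF _ assms] by (simp add: valid_block_def)
qed

lemma valid_block_codes: "\<omega> \<in> space M \<Longrightarrow> \<forall>z\<in>set (codes k \<omega>). valid_block z"
  by (induction k) (auto simp: codes_Suc valid_block_code)

lemma total_span_codes:
  assumes "\<omega> \<in> space M"
  shows "total_span (codes k \<omega>) = partial_sum Y k \<omega> + partial_sum X k \<omega>"
proof (induction k)
  case (Suc k)
  obtain y \<alpha> where z: "code (Suc k) \<omega> = (y, \<alpha>)" by force
  from z[unfolded code_Suc_eq_iff[OF assms refl]] Suc show ?case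
    by (simp add: codes_Suc z partial_sum_Suc)
qed (simp add: partial_sum_def)

text \<open>Iterates \<open>code_Suc_eq_iff\<close>. On the right all indices are determined by
  \<open>zs\<close>, so that independence can be applied.\<close>

lemma codes_eq_iff:
  assumes "\<omega> \<in> space M"
  shows "codes (length zs) \<omega> = zs \<longleftrightarrow>
    (\<forall>j\<in>{1..length zs}. X j \<omega> = length (snd (zs ! (j - 1))) \<and> Y j \<omega> = fst (zs ! (j - 1)) \<and>
      P (block_range zs j) \<omega> = block_listing zs j)"
proof (induction zs rule: rev_induct)
  case (snoc z zs)
  let ?Q = "\<lambda>zs j. X j \<omega> = length (snd (zs ! (j - 1))) \<and> Y j \<omega> = fst (zs ! (j - 1)) \<and>
      P (block_range zs j) \<omega> = block_listing zs j"
  \<comment> \<open>If the earlier codes are \<open>zs\<close>, then \<open>T\<close> equals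
    \<open>total_span zs\<close> and is no longer random.\<close>
  have last: "code (Suc (length zs)) \<omega> = z \<longleftrightarrow> ?Q (zs @ [z]) (Suc (length zs))"
    if "codes (length zs) \<omega> = zs"
  proof -
    have "total_span zs = partial_sum Y (length zs) \<omega> + partial_sum X (length zs) \<omega>"
      using total_span_codes[OF assms, of "length zs"] that by simp
    from code_Suc_eq_iff[OF assms this, of "fst z" "snd z"] show ?thesis
      by (simp add: block_range_def block_listing_def block_start_snoc)
  qed
  have old: "?Q (zs @ [z]) j \<longleftrightarrow> ?Q zs j" if "j \<in> {1..length zs}" for j
  proof -
    have "(zs @ [z]) ! (j - 1) = zs ! (j - 1)"
      using that by (auto simp: nth_append)
    then show ?thesis
      by (simp only: block_range_def block_listing_def block_start_snoc(1)[OF that])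
  qed
  have "codes (length (zs @ [z])) \<omega> = zs @ [z] \<longleftrightarrow>
      codes (length zs) \<omega> = zs \<and> code (Suc (length zs)) \<omega> = z"
    by (simp add: codes_Suc)
  also have "\<dots> \<longleftrightarrow> codes (length zs) \<omega> = zs \<and> ?Q (zs @ [z]) (Suc (length zs))"
    using last by blast
  also have "\<dots> \<longleftrightarrow> (\<forall>j\<in>{1..length zs}. ?Q (zs @ [z]) j) \<and> ?Q (zs @ [z]) (Suc (length zs))"
    unfolding snoc.IH using old by blast
  also have "\<dots> \<longleftrightarrow> (\<forall>j\<in>{1..Suc (length zs)}. ?Q (zs @ [z]) j)"
    using atLeastAtMostSuc_conv[of 1 "length zs"] by (simp only: le_add1 plus_1_eq_Suc simp_thms) blast
  finally show ?case by simp
qed simp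

lemma concat_listings:
  assumes "\<omega> \<in> space M"
  shows "concat (map (\<lambda>j. P (random_block j \<omega>) \<omega> @ [offset j \<omega>]) [1..<Suc k]) = block_word (codes k \<omega>)"
proof (induction k)
  case (Suc k)
  let ?T = "partial_sum Y k \<omega> + partial_sum X k \<omega>"
  obtain y \<alpha> where z: "code (Suc k) \<omega> = (y, \<alpha>)" by force
  have *: "X (Suc k) \<omega> = length \<alpha>" "Y (Suc k) \<omega> = y"
      "P {?T + y + 1..?T + y + length \<alpha>} \<omega> = map ((+) (?T + y)) \<alpha>"
    using z unfolding code_Suc_eq_iff[OF assms refl] by blast+
  have off: "offset (Suc k) \<omega> = ?T + y"
    by (simp add: offset_def partial_sum_Suc *)
  show ?case
    using Suc * by (simp add: codes_Suc z block_word_snoc total_span_codes[OF assms] off random_block_Suc)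
qed simp

lemma limit_perm_eq:
  "limit_perm X Y P \<omega> = infinite_concat (\<lambda>j. P (random_block j \<omega>) \<omega> @ [offset j \<omega>])"
  by (simp add: limit_perm_def random_block_def offset_def)

lemma limit_perm_nth:
  assumes "\<omega> \<in> space M" "i < length (block_word (codes k \<omega>))"
  shows "limit_perm X Y P \<omega> (Suc i) = enat (block_word (codes k \<omega>) ! i)"
  unfolding limit_perm_eq concat_listings[OF assms(1), symmetric]
proof (rule infinite_concat_nth)
  show "i < length (concat (map (\<lambda>j. P (random_block j \<omega>) \<omega> @ [offset j \<omega>]) [1..<Suc k]))"
    unfolding concat_listings[OF assms(1)] by (rule assms(2))
qed simp

lemma block_word_codes_Suc: "\<exists>v. block_word (codes (Suc k) \<omega>) = block_word (codes k \<omega>) @ v"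
  by (cases "code (Suc k) \<omega>") (simp add: codes_Suc block_word_snoc)

lemma length_block_word: "length zs \<le> length (block_word zs)"
  by (induction zs rule: block_word.induct) (auto simp: glue_def)

lemma limit_perm_nth':
  assumes "\<omega> \<in> space M" "i < k"
  shows "limit_perm X Y P \<omega> (Suc i) = enat (block_word (codes k \<omega>) ! i)"
  using assms length_block_word[of "codes k \<omega>"] by (intro limit_perm_nth) auto

text \<open>Any two positions lie in a common prefix \<open>block_word (codes k \<omega>)\<close>,
  to which \<open>block_word_props\<close> applies.\<close>

lemma limit_perm_in_S_NN:
  assumes "\<omega> \<in> space M"
  shows "limit_perm X Y P \<omega> \<in> S_NN"
proof -
  let ?L = "limit_perm X Y P \<omega>"
  have len: "k \<le> length (block_word (codes k \<omega>))" for k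
    using length_block_word[of "codes k \<omega>"] by simp
  have "?L i \<in> enat ` {1..}" if "1 \<le> i" for i
  proof -
    obtain i' where i: "i = Suc i'" using \<open>1 \<le> i\<close> by (cases i) auto
    have "block_word (codes i \<omega>) ! i' \<in> set (block_word (codes i \<omega>))"
      using len[of i] by (simp add: i)
    then show ?thesis
      using limit_perm_nth'[OF assms, of i' i] block_word_props(2)[OF valid_block_codes[OF assms]]
      by (auto simp: i)
  qed
  moreover have "?L \<in> extensional {1..}"
    by (simp add: limit_perm_eq infinite_concat_def)
  moreover have "inj_on ?L {1..}"
  proof (rule inj_onI)
    fix i j :: nat assume ij: "i \<in> {1..}" "j \<in> {1..}" "?L i = ?L j"
    then obtain i' j' where s: "i = Suc i'" "j = Suc j'" by (cases i; cases j) auto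
    let ?k = "max i j"
    have "block_word (codes ?k \<omega>) ! i' = block_word (codes ?k \<omega>) ! j'"
      using ij(3) limit_perm_nth'[OF assms, of i' ?k] limit_perm_nth'[OF assms, of j' ?k]
      by (simp add: s)
    then show "i = j"
      using len[of ?k] block_word_props(1)[OF valid_block_codes[OF assms], of ?k]
      by (simp add: nth_eq_iff_index_eq s)
  qed
  ultimately show ?thesis
    by (auto simp: S_NN_def PiE_def)
qed

lemma limit_perm_in_cylinder:
  assumes "\<omega> \<in> space M"
  shows "limit_perm X Y P \<omega> \<in> cylinder (block_word (codes k \<omega>))"
proof -
  have "enat ` {1..} \<subseteq> {1..}"
    by (auto simp: one_enat_def)
  then have "{1..} \<rightarrow>\<^sub>E enat ` {1..} \<subseteq> {1..} \<rightarrow>\<^sub>E {1..}"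
    by (rule PiE_mono)
  moreover have "inj_on \<sigma> {i \<in> {1..}. \<sigma> i \<noteq> \<infinity>}" if "inj_on \<sigma> {1..}" for \<sigma> :: "nat \<Rightarrow> enat"
    using that by (rule inj_on_subset) auto
  ultimately have "S_NN \<subseteq> S_NNstar"
    unfolding S_NN_def S_NNstar_def by blast
  then show ?thesis
    using limit_perm_in_S_NN[OF assms] limit_perm_nth[OF assms] by (auto simp: cylinder_def)
qed

lemma limit_perm_notin_S_infinity:
  assumes "\<omega> \<in> space M" "2 \<le> Y (Suc m) \<omega>"
  shows "limit_perm X Y P \<omega> \<notin> S_infinity"
proof
  obtain \<alpha> where z: "code (Suc m) \<omega> = (Y (Suc m) \<omega>, \<alpha>)"
    by (simp add: code_def)
  \<comment> \<open>The largest value skipped by block \<open>Suc m\<close>; it is positive because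
    \<open>Y (Suc m) \<omega>\<close> is at least 2.\<close>
  define v where "v = total_span (codes m \<omega>) + Y (Suc m) \<omega> - 1"
  have notin: "v \<notin> set (block_word (codes k \<omega>))" if "Suc m \<le> k" for k
  proof -
    have "\<exists>vs. codes k \<omega> = codes m \<omega> @ code (Suc m) \<omega> # vs"
      using that by (induction k rule: dec_induct) (auto simp: codes_Suc)
    then obtain vs where vs: "codes k \<omega> = codes m \<omega> @ (Y (Suc m) \<omega>, \<alpha>) # vs"
      unfolding z by blast
    show ?thesis
      using skipped_notin_block_word[OF valid_block_codes[OF assms(1), of k, unfolded vs] assms(2)]
      unfolding vs v_def .
  qed
  assume "limit_perm X Y P \<omega> \<in> S_infinity"
  then have "limit_perm X Y P \<omega> ` {1..} = enat ` {1..}"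
    unfolding S_infinity_def bij_betw_def by blast
  moreover have "enat v \<in> enat ` {1..}"
    using assms(2) by (simp add: v_def)
  ultimately have "enat v \<in> limit_perm X Y P \<omega> ` {1..}"
    by simp
  then obtain i where "i \<in> {1..}" and i: "limit_perm X Y P \<omega> i = enat v"
    by (metis imageE)
  then obtain i' where i': "i = Suc i'"
    by (cases i) simp_all
  \<comment> \<open>Enough blocks to cover position \<open>i\<close> and to include block
    \<open>Suc m\<close>.\<close>
  let ?k = "max i (Suc m)"
  have "block_word (codes ?k \<omega>) ! i' = v"
    using limit_perm_nth'[OF assms(1), of i' ?k] i by (simp add: i')
  moreover have "i' < length (block_word (codes ?k \<omega>))"
    using length_block_word[of "codes ?k \<omega>"] by (simp add: i')
  ultimately show False
    using notin[of ?k] nth_mem[of i' "block_word (codes ?k \<omega>)"] by simp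
qed

section \<open>Law of the codes\<close>

lemma X_event: "{\<omega> \<in> space M. X n \<omega> = k} \<in> generated_events M (count_space UNIV) (X n)"
  by (auto simp: generated_events_def intro!: exI[of _ "{k}"])

lemma Y_event: "{\<omega> \<in> space M. Y n \<omega> = k} \<in> generated_events M (count_space UNIV) (Y n)"
  by (auto simp: generated_events_def intro!: exI[of _ "{k}"])

lemma P_event: "{\<omega> \<in> space M. Q (P I \<omega>)} \<in> generated_events M (count_space UNIV) (P I)"
  by (auto simp: generated_events_def intro!: exI[of _ "Collect Q"])

lemma prob_P_interval:
  assumes "\<alpha> \<in> avoiders x"
  shows "\<P>(\<omega> in M. P {a + 1..a + x} \<omega> = map ((+) a) \<alpha>) = 1 / catalan x"
proof -
  let ?I = "{a + 1..a + x}"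
  let ?S = "avoiding_images ?I [3, 1, 2]"
  have I: "?I \<in> blocks" by (rule interval_in_blocks)
  have mem: "map ((+) a) \<alpha> \<in> ?S"
    unfolding avoiding_images_interval using assms by blast
  have fin: "finite ?S"
    unfolding avoiding_images_interval by simp
  have "inj_on (map ((+) a)) (avoiders x)"
    by (rule inj_on_subset[OF inj_mapI]) auto
  then have "card ?S = card (avoiders x)"
    unfolding avoiding_images_interval by (rule card_image)
  then have card: "real (card ?S) = catalan x"
    by (simp only: card_avoiders)
  have "{\<omega> \<in> space M. P ?I \<omega> = map ((+) a) \<alpha>} = P ?I -` {map ((+) a) \<alpha>} \<inter> space M"
    by auto
  then have "\<P>(\<omega> in M. P ?I \<omega> = map ((+) a) \<alpha>) =
      measure (distr M (count_space ?S) (P ?I)) {map ((+) a) \<alpha>}"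
    using mem by (subst measure_distr[OF P_meas[OF I]]) simp_all
  also have "\<dots> = measure (uniform_count_measure ?S) {map ((+) a) \<alpha>}"
    by (simp only: P_dist[OF I])
  also have "\<dots> = 1 / catalan x"
    using mem fin card by (subst measure_uniform_count_measure) simp_all
  finally show ?thesis .
qed

text \<open>The events \<open>X 1 = k\<close> partition the space, so the value of the Catalan
  series follows from countable additivity and the given law of \<open>X 1\<close>.\<close>

lemma catalan_sums_1: "(\<lambda>k. catalan k / (2 * 4 ^ k)) sums 1"
proof -
  let ?A = "\<lambda>k. {\<omega> \<in> space M. X 1 \<omega> = k}"
  have meas: "?A k \<in> sets M" for k
  proof -
    have "?A k = X 1 -` {k} \<inter> space M" by auto
    then show ?thesis using measurable_sets[OF X_meas[of 1], of "{k}"] by simp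
  qed
  have "(\<lambda>k. prob (?A k)) sums prob (\<Union>k. ?A k)"
    using meas by (intro finite_measure_UNION) (auto simp: disjoint_family_on_def)
  moreover have "(\<Union>k. ?A k) = space M" by auto
  ultimately show ?thesis
    using X_dist[of 1] by (simp add: prob_space)
qed

lemma codes_event:
  assumes "length zs = k"
  shows "{\<omega> \<in> space M. codes k \<omega> = zs} = {\<omega> \<in> space M. \<forall>j\<in>{1..k}.
    X j \<omega> = length (snd (zs ! (j - 1))) \<and> Y j \<omega> = fst (zs ! (j - 1)) \<and> P (block_range zs j) \<omega> = block_listing zs j}"
  by (intro Collect_cong conj_cong refl) (rule codes_eq_iff[of _ zs, unfolded assms])

text \<open>All empty ranges are the same set, so one range is taken nonempty. Equality then fixes
  the left endpoint, which strictly increases with the position.\<close>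

lemma inj_block_range:
  assumes "\<forall>z\<in>set zs. valid_block z" "i \<in> {1..length zs}" "j \<in> {1..length zs}"
    and "snd (zs ! (i - 1)) \<noteq> []" "block_range zs i = block_range zs j"
  shows "i = j"
proof (rule ccontr)
  assume "i \<noteq> j"
  have le: "block_start zs i = block_start zs j"
    using assms(4,5) unfolding block_range_def Icc_eq_Icc by (auto simp: Suc_le_eq)
  consider "i < j" | "j < i"
    using \<open>i \<noteq> j\<close> by linarith
  then show False
  proof cases
    case 1
    then have "block_start zs i + length (snd (zs ! (i - 1))) < block_start zs j"
      using assms(2,3) by (intro block_start_less[OF assms(1)]) simp_all
    with le show False by linarith
  next
    case 2
    then have "block_start zs j + length (snd (zs ! (j - 1))) < block_start zs i"
      using assms(2,3) by (intro block_start_less[OF assms(1)]) simp_all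
    with le show False by linarith
  qed
qed

text \<open>Independence factorizes the event of \<open>codes_eq_iff\<close>. The factor
  \<open>catalan x\<close> in the law of \<open>X\<close> cancels against the
  \<open>1 / catalan x\<close> of the uniform listing.\<close>

lemma prob_codes:
  assumes v: "\<forall>z\<in>set zs. valid_block z" and len: "length zs = k"
  shows "{\<omega> \<in> space M. codes k \<omega> = zs} \<in> sets M"
    and "prob {\<omega> \<in> space M. codes k \<omega> = zs} =
      (\<Prod>j=1..k. (1 / 2) ^ fst (zs ! (j - 1)) / (2 * 4 ^ length (snd (zs ! (j - 1)))))"
proof -
  define x where "x j = length (snd (zs ! (j - 1)))" for j
  define y where "y j = fst (zs ! (j - 1))" for j
  have valid: "valid_block (zs ! (j - 1))" if "j \<in> {1..k}" for j
    using v len that nth_mem[of "j - 1" zs] by fastforce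
  have y1: "1 \<le> y j" and \<alpha>: "snd (zs ! (j - 1)) \<in> avoiders (x j)" if "j \<in> {1..k}" for j
    using valid[OF that] by (auto simp: valid_block_def x_def y_def split: prod.splits)
  \<comment> \<open>Empty blocks share the single index \<open>{}\<close>, where the listing is
    always \<open>[]\<close>; only the positions in \<open>K\<close> contribute an event about
    \<open>P\<close>.\<close>
  define K where "K = {j \<in> {1..k}. x j \<noteq> 0}"
  have inj: "inj_on (block_range zs) K"
    using inj_block_range[OF v] len by (auto simp: inj_on_def K_def x_def)
  define evX where "evX j = {\<omega> \<in> space M. X j \<omega> = x j}" for j
  define evY where "evY j = {\<omega> \<in> space M. Y j \<omega> = y j}" for j
  \<comment> \<open>Independence is indexed by blocks, so the event must be a function of
    \<open>I\<close>; for \<open>I\<close> in the image of \<open>K\<close> exactly one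
    \<open>j\<close> matches.\<close>
  define evP where "evP I = {\<omega> \<in> space M. \<forall>j\<in>{1..k}. block_range zs j = I \<longrightarrow> P I \<omega> = block_listing zs j}" for I
  define J where "J = {1..k} <+> ({1..k} <+> block_range zs ` K)"
  define A where "A = case_sum evX (case_sum evY evP)"
  let ?gen = "case_sum (\<lambda>n. generated_events M (count_space UNIV) (X n))
         (case_sum (\<lambda>n. generated_events M (count_space UNIV) (Y n))
           (\<lambda>I. generated_events M (count_space UNIV) (P I)))"
  have indep': "indep_sets ?gen ({1..} <+> ({1..} <+> blocks))"
    using indep by (simp add: mutually_independent_def)
  have blocks: "block_range zs j \<in> blocks" for j
    unfolding block_range_def by (rule interval_in_blocks)
  have JI: "J \<subseteq> {1..} <+> ({1..} <+> blocks)"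
    using blocks by (auto simp: J_def)
  have AJ: "\<forall>i\<in>J. A i \<in> ?gen i"
    unfolding J_def A_def
    by (auto simp: evX_def evY_def evP_def intro!: X_event Y_event P_event)
  have finJ: "finite J"
    by (simp add: J_def K_def)
  have P_empty: "P {} \<omega> = []" if "\<omega> \<in> space M" for \<omega>
  proof -
    have "{} \<in> blocks" using interval_in_blocks[of 0 0] by simp
    from P_mem[OF this that] show ?thesis unfolding avoiding_images_312 by simp
  qed
  have "K \<subseteq> {1..k}" by (auto simp: K_def)
  have evP_eq: "evP (block_range zs j) = {\<omega> \<in> space M. P (block_range zs j) \<omega> = block_listing zs j}" if "j \<in> K" for j
  proof -
    have "i = j" if "i \<in> {1..k}" "block_range zs i = block_range zs j" for i
      using inj_block_range[OF v, of j i] that \<open>j \<in> K\<close> len by (simp add: K_def x_def)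
    then show ?thesis
      using \<open>j \<in> K\<close> \<open>K \<subseteq> {1..k}\<close> unfolding evP_def by blast
  qed
  have event: "{\<omega> \<in> space M. codes k \<omega> = zs} = space M \<inter> (\<Inter>i\<in>J. A i)"
  proof -
    have "\<omega> \<in> (\<Inter>i\<in>J. A i) \<longleftrightarrow> (\<forall>j\<in>{1..k}. X j \<omega> = x j \<and> Y j \<omega> = y j \<and> P (block_range zs j) \<omega> = block_listing zs j)"
      if \<omega>: "\<omega> \<in> space M" for \<omega>
    proof -
      have "\<omega> \<in> (\<Inter>i\<in>J. A i) \<longleftrightarrow>
        (\<forall>j\<in>{1..k}. X j \<omega> = x j) \<and> (\<forall>j\<in>{1..k}. Y j \<omega> = y j) \<and> (\<forall>j\<in>K. \<omega> \<in> evP (block_range zs j))"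
        using \<omega> by (simp add: J_def A_def Plus_def ball_Un evX_def evY_def)
      moreover have "P (block_range zs j) \<omega> = block_listing zs j" if "j \<in> {1..k} - K" for j
        using that P_empty[OF \<omega>] by (auto simp: K_def x_def block_range_def block_listing_def)
      then have "(\<forall>j\<in>K. \<omega> \<in> evP (block_range zs j)) \<longleftrightarrow> (\<forall>j\<in>{1..k}. P (block_range zs j) \<omega> = block_listing zs j)"
        using evP_eq \<omega> \<open>K \<subseteq> {1..k}\<close> by blast
      ultimately show ?thesis
        by (simp only: ball_conj_distrib)
    qed
    then show ?thesis
      unfolding codes_event[OF len] x_def[symmetric] y_def[symmetric] by auto
  qed
  have sets: "A i \<in> sets M" if "i \<in> J" for i
  proof -
    have "?gen i \<subseteq> sets M"
      using indep' JI that by (auto simp: indep_sets_def)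
    then show ?thesis using AJ that by auto
  qed
  have factor: "prob (evX j) = catalan (x j) / (2 * 4 ^ x j)" "prob (evY j) = (1 / 2) ^ y j"
    if "j \<in> {1..k}" for j
    using X_dist[of j "x j"] Y_dist[of j "y j"] y1[OF that] that by (auto simp: evX_def evY_def)
  have evP: "prob (evP (block_range zs j)) = 1 / catalan (x j)" if "j \<in> K" for j
    unfolding evP_eq[OF that] using prob_P_interval[OF \<alpha>[of j], of "block_start zs j"] that
    by (simp add: block_range_def block_listing_def x_def K_def)
  have "{\<omega> \<in> space M. codes k \<omega> = zs} \<in> sets M \<and>
    prob {\<omega> \<in> space M. codes k \<omega> = zs} = (\<Prod>j=1..k. (1 / 2) ^ y j / (2 * 4 ^ x j))"
  \<comment> \<open>Independence speaks of nonempty index sets, and \<open>J\<close> is empty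
    exactly for \<open>k = 0\<close>.\<close>
  proof (cases "k = 0")
    case True
    then show ?thesis using len by (simp add: prob_space)
  next
    case False
    then have J: "J \<noteq> {}" by (auto simp: J_def)
    have INT: "(\<Inter>i\<in>J. A i) \<in> sets M"
      using sets finJ J by (intro sets.finite_INT) auto
    then have eq: "{\<omega> \<in> space M. codes k \<omega> = zs} = (\<Inter>i\<in>J. A i)"
      unfolding event using sets.sets_into_space by blast
    have "prob (\<Inter>i\<in>J. A i) = (\<Prod>i\<in>J. prob (A i))"
      by (rule indep_setsD[OF indep' JI J finJ AJ])
    also have "\<dots> = (\<Prod>j=1..k. prob (evX j)) * ((\<Prod>j=1..k. prob (evY j)) * (\<Prod>I\<in>block_range zs ` K. prob (evP I)))"
      by (simp add: J_def A_def prod.Plus K_def o_def)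
    also have "(\<Prod>I\<in>block_range zs ` K. prob (evP I)) = (\<Prod>j\<in>K. 1 / catalan (x j))"
      by (simp add: prod.reindex[OF inj] evP)
    \<comment> \<open>The positions outside \<open>K\<close> have \<open>x j = 0\<close> and add
      only factors \<open>1 / catalan 0 = 1\<close>.\<close>
    also have "\<dots> = (\<Prod>j=1..k. 1 / catalan (x j))"
      by (rule prod.mono_neutral_left) (auto simp: K_def)
    also have "(\<Prod>j=1..k. prob (evX j)) * ((\<Prod>j=1..k. prob (evY j)) * (\<Prod>j=1..k. 1 / catalan (x j))) =
        (\<Prod>j=1..k. prob (evX j) * (prob (evY j) * (1 / catalan (x j))))"
      by (simp only: prod.distrib)
    also have "\<dots> = (\<Prod>j=1..k. (1 / 2) ^ y j / (2 * 4 ^ x j))"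
    proof (rule prod.cong[OF refl])
      fix j assume "j \<in> {1..k}"
      then show "prob (evX j) * (prob (evY j) * (1 / catalan (x j))) = (1 / 2) ^ y j / (2 * 4 ^ x j)"
        using catalan_pos[of "x j"] by (simp add: factor)
    qed
    finally show ?thesis using INT by (simp add: eq)
  qed
  then show "{\<omega> \<in> space M. codes k \<omega> = zs} \<in> sets M"
    "prob {\<omega> \<in> space M. codes k \<omega> = zs} =
      (\<Prod>j=1..k. (1 / 2) ^ fst (zs ! (j - 1)) / (2 * 4 ^ length (snd (zs ! (j - 1)))))"
    by (simp_all add: x_def y_def)
qed

lemma prod_list_block_weight:
  assumes "\<forall>z\<in>set zs. valid_block z"
  shows "prod_list (map block_weight zs) =
    ennreal (\<Prod>j=1..length zs. (1 / 2) ^ fst (zs ! (j - 1)) / (2 * 4 ^ length (snd (zs ! (j - 1)))))"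
  using assms
proof (induction zs rule: rev_induct)
  case (snoc z zs)
  have z: "block_weight z = ennreal ((1 / 2) ^ fst z / (2 * 4 ^ length (snd z)))"
  proof -
    obtain y \<alpha> where z: "z = (Suc y, \<alpha>)" "\<alpha> \<in> avoiders (length \<alpha>)"
      using snoc.prems by (cases z; cases "fst z") (auto simp: valid_block_def)
    then show ?thesis
      by (simp add: block_weight_def avoider_weight_def flip: ennreal_mult)
  qed
  have "(\<Prod>j=1..length zs. (1 / 2 :: real) ^ fst ((zs @ [z]) ! (j - 1)) / (2 * 4 ^ length (snd ((zs @ [z]) ! (j - 1))))) =
    (\<Prod>j=1..length zs. (1 / 2) ^ fst (zs ! (j - 1)) / (2 * 4 ^ length (snd (zs ! (j - 1)))))"
    by (rule prod.cong[OF refl]) (auto simp: nth_append)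
  then have eq: "(\<Prod>j=1..length (zs @ [z]). (1 / 2 :: real) ^ fst ((zs @ [z]) ! (j - 1)) / (2 * 4 ^ length (snd ((zs @ [z]) ! (j - 1))))) =
    (\<Prod>j=1..length zs. (1 / 2) ^ fst (zs ! (j - 1)) / (2 * 4 ^ length (snd (zs ! (j - 1))))) *
      ((1 / 2) ^ fst z / (2 * 4 ^ length (snd z)))"
    by simp
  have IH: "prod_list (map block_weight zs) =
      ennreal (\<Prod>j=1..length zs. (1 / 2) ^ fst (zs ! (j - 1)) / (2 * 4 ^ length (snd (zs ! (j - 1)))))"
    using snoc by simp
  show ?case
    unfolding eq by (subst ennreal_mult) (simp_all add: z IH prod_nonneg)
qed simp

lemma codes_measurable: "codes k \<in> M \<rightarrow>\<^sub>M count_space UNIV"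
proof (subst measurable_count_space_eq_countable[OF countableI_type], intro conjI ballI)
  fix zs
  have eq: "codes k -` {zs} \<inter> space M = {\<omega> \<in> space M. codes k \<omega> = zs}" by auto
  show "codes k -` {zs} \<inter> space M \<in> sets M"
  proof (cases "(\<forall>z\<in>set zs. valid_block z) \<and> length zs = k")
    case True
    then show ?thesis unfolding eq by (intro prob_codes) auto
  next
    case False
    then have "codes k -` {zs} \<inter> space M = {}"
      using valid_block_codes[of _ k] by auto
    then show ?thesis by simp
  qed
qed simp

lemma block_weight_eq_0: "\<not> valid_block z \<Longrightarrow> block_weight z = 0"
  by (auto simp: valid_block_def block_weight_def avoider_weight_def split: prod.splits)

lemma emeasure_codes:
  "emeasure M {\<omega> \<in> space M. codes k \<omega> = zs} =
    prod_list (map block_weight zs) * indicator {zs. length zs = k} zs"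
proof (cases "(\<forall>z\<in>set zs. valid_block z) \<and> length zs = k")
  case True
  then show ?thesis
    using prob_codes(2)[of zs k] prod_list_block_weight[of zs] by (simp add: emeasure_eq_measure)
next
  case False
  then have empty: "{\<omega> \<in> space M. codes k \<omega> = zs} = {}"
    using valid_block_codes[of _ k] by auto
  show ?thesis
  proof (cases "length zs = k")
    case True
    then obtain z where "z \<in> set zs" "\<not> valid_block z" using False by auto
    then have "0 \<in> set (map block_weight zs)"
      using block_weight_eq_0[of z] image_eqI[of 0 block_weight z "set zs"] by simp
    then have "prod_list (map block_weight zs) = 0"
      by (simp only: prod_list_zero_iff)
    then show ?thesis unfolding empty by simp
  qed (simp add: empty)
qed

lemma nn_integral_block_word_codes:
  "(\<integral>\<^sup>+\<omega>. g (block_word (codes k \<omega>)) \<partial>M) =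
    (\<integral>\<^sup>+zs. prod_list (map block_weight zs) * g (block_word zs) \<partial>count_space {zs. length zs = k})"
proof -
  let ?p = "\<lambda>zs. prod_list (map block_weight zs) * indicator {zs. length zs = k} zs"
  have "distr M (count_space UNIV) (codes k) = density (count_space UNIV) ?p"
  proof (rule measure_eqI_countable[of _ UNIV])
    fix zs :: "(nat \<times> nat list) list"
    have "emeasure (distr M (count_space UNIV) (codes k)) {zs} = ?p zs"
      unfolding emeasure_codes[symmetric]
      by (subst emeasure_distr[OF codes_measurable]) (auto intro!: arg_cong[of _ _ "emeasure M"])
    then show "emeasure (distr M (count_space UNIV) (codes k)) {zs} =
        emeasure (density (count_space UNIV) ?p) {zs}"
      by (simp add: emeasure_density nn_integral_count_space_indicator[symmetric])
  qed auto
  then have "(\<integral>\<^sup>+zs. g (block_word zs) \<partial>distr M (count_space UNIV) (codes k)) =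
      (\<integral>\<^sup>+zs. ?p zs * g (block_word zs) \<partial>count_space UNIV)"
    by (simp only: nn_integral_density borel_measurable_count_space)
  then show ?thesis
    by (subst nn_integral_count_space_indicator)
      (simp_all add: nn_integral_distr[OF codes_measurable] mult_ac)
qed

text \<open>By independence the first \<open>k\<close> values of \<open>Y\<close> are all 1 with
  probability \<open>(1 / 2) ^ k\<close>, which tends to 0.\<close>

lemma AE_Y_ge_2: "AE \<omega> in M. \<exists>m. 2 \<le> Y (Suc m) \<omega>"
proof -
  define evY where "evY j = {\<omega> \<in> space M. Y j \<omega> = 1}" for j
  have indep': "indep_sets (case_sum (\<lambda>n. generated_events M (count_space UNIV) (X n))
         (case_sum (\<lambda>n. generated_events M (count_space UNIV) (Y n))
           (\<lambda>I. generated_events M (count_space UNIV) (P I)))) ({1..} <+> ({1..} <+> blocks))"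
    using indep by (simp add: mutually_independent_def)
  have evY: "evY j \<in> sets M" if "j \<ge> 1" for j
  proof -
    have "evY j = Y j -` {1} \<inter> space M" by (auto simp: evY_def)
    then show ?thesis using measurable_sets[OF Y_meas[OF that], of "{1}"] by simp
  qed
  let ?N = "\<Inter>j\<in>{1..}. evY j"
  have N: "?N \<in> sets M"
    using evY by (intro sets.countable_INT') auto
  have "prob ?N \<le> (1 / 2) ^ k" if "k \<ge> 1" for k
  proof -
    let ?J = "(Inr \<circ> Inl) ` {1..k} :: (nat + nat + nat set) set"
    \<comment> \<open>Every index in \<open>?J\<close> has the form \<open>Inr (Inl j)\<close>, so
      only the middle component of \<open>case_sum\<close> is evaluated; the other two are
      fillers.\<close>
    have "prob (\<Inter>i\<in>?J. case_sum evY (case_sum evY (\<lambda>_. {})) i) =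
        (\<Prod>i\<in>?J. prob (case_sum evY (case_sum evY (\<lambda>_. {})) i))"
    proof (rule indep_setsD[OF indep'])
      show "\<forall>j\<in>?J. case_sum evY (case_sum evY (\<lambda>_. {})) j \<in> case_sum (\<lambda>n. generated_events M (count_space UNIV) (X n))
         (case_sum (\<lambda>n. generated_events M (count_space UNIV) (Y n))
           (\<lambda>I. generated_events M (count_space UNIV) (P I))) j"
        using Y_event[of _ 1] by (auto simp: evY_def)
    qed (use that in auto)
    then have "prob (\<Inter>j\<in>{1..k}. evY j) = (\<Prod>j\<in>{1..k}. prob (evY j))"
      by (simp add: prod.reindex inj_on_def image_comp)
    also have "\<dots> = (\<Prod>j\<in>{1..k}. 1 / 2)"
      using Y_dist[of _ 1] by (intro prod.cong) (auto simp: evY_def)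
    finally have "prob (\<Inter>j\<in>{1..k}. evY j) = (1 / 2) ^ k" by simp
    moreover have "prob ?N \<le> prob (\<Inter>j\<in>{1..k}. evY j)"
    proof (rule finite_measure_mono)
      show "(\<Inter>j\<in>{1..k}. evY j) \<in> sets M"
        using that evY by (intro sets.finite_INT) auto
    qed auto
    ultimately show ?thesis by simp
  qed
  then have "prob ?N \<le> 0"
    by (intro LIMSEQ_le_const[OF LIMSEQ_realpow_zero[of "1 / 2"]]) auto
  then have "?N \<in> null_sets M"
    using N by (simp add: null_sets_def emeasure_eq_measure measure_le_0_iff)
  moreover have "{\<omega> \<in> space M. \<not> (\<exists>m. 2 \<le> Y (Suc m) \<omega>)} \<subseteq> ?N"
  proof
    fix \<omega> assume \<omega>: "\<omega> \<in> {\<omega> \<in> space M. \<not> (\<exists>m. 2 \<le> Y (Suc m) \<omega>)}"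
    have "Y j \<omega> = 1" if "j \<ge> 1" for j
      using \<omega> Y_ge_1[OF that, of \<omega>] that by (cases j) (auto simp: not_le less_Suc_eq_le numeral_2_eq_2 le_antisym)
    then show "\<omega> \<in> ?N" using \<omega> by (simp add: evY_def)
  qed
  ultimately show ?thesis by (rule AE_I')
qed

lemma limit_perm_limit_law:
  "limit_perm X Y P \<in> M \<rightarrow>\<^sub>M borel_of_top top_S \<and>
    weakly_converges top_S (mu [3, 1, 2]) (distr M (borel_of_top top_S) (limit_perm X Y P)) \<and>
    (AE \<omega> in M. limit_perm X Y P \<omega> \<in> S_NN - S_infinity)"
proof -
  have meas: "(\<lambda>\<omega>. block_word (codes k \<omega>)) \<in> M \<rightarrow>\<^sub>M count_space UNIV" for k
    by (rule measurable_compose[OF codes_measurable]) simp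
  have len: "k \<le> length (block_word (codes k \<omega>))" for k \<omega>
    using length_block_word[of "codes k \<omega>"] by simp
  have dom: "(\<integral>\<^sup>+\<omega>. g (block_word (codes k \<omega>)) \<partial>M) \<le> avoider_liminf g" if "prefix_mono g" for k g
    unfolding nn_integral_block_word_codes
    by (rule avoider_liminf_ge_blocks[OF catalan_sums_1 that])
  note conv = weak_convergence_if_prefix_dominated[where W = "\<lambda>k \<omega>. block_word (codes k \<omega>)",
      OF prob_space_axioms meas len block_word_codes_Suc limit_perm_in_cylinder dom]
  have "AE \<omega> in M. limit_perm X Y P \<omega> \<in> S_NN - S_infinity"
    using AE_Y_ge_2 AE_space
    by eventually_elim (use limit_perm_in_S_NN limit_perm_notin_S_infinity in blast)
  with conv show ?thesis by simp
qed

end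

theorem theorem1:
  fixes M :: "'a measure"
    and X Y :: "nat \<Rightarrow> 'a \<Rightarrow> nat"
    and P :: "nat set \<Rightarrow> 'a \<Rightarrow> nat list"
  assumes "prob_space M"
    and "\<And>n. n \<ge> 1 \<Longrightarrow> X n \<in> M \<rightarrow>\<^sub>M count_space UNIV"
    and "\<And>n. n \<ge> 1 \<Longrightarrow> Y n \<in> M \<rightarrow>\<^sub>M count_space {1..}"
    and "\<And>I. I \<in> blocks \<Longrightarrow> P I \<in> M \<rightarrow>\<^sub>M count_space (avoiding_images I [3, 1, 2])"
    and "mutually_independent M X Y P"
    and "\<And>n k. n \<ge> 1 \<Longrightarrow> \<P>(\<omega> in M. X n \<omega> = k) = catalan k / (2 * 4 ^ k)"
    and "\<And>n k. n \<ge> 1 \<Longrightarrow> k \<ge> 1 \<Longrightarrow> \<P>(\<omega> in M. Y n \<omega> = k) = (1 / 2) ^ k"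
    and "\<And>I. I \<in> blocks \<Longrightarrow>
           distr M (count_space (avoiding_images I [3, 1, 2])) (P I) = uniform_count_measure (avoiding_images I [3, 1, 2])"
  shows "limit_perm X Y P \<in> M \<rightarrow>\<^sub>M borel_of_top top_S \<and>
    weakly_converges top_S (mu [3, 1, 2]) (distr M (borel_of_top top_S) (limit_perm X Y P)) \<and>
    (AE \<omega> in M. limit_perm X Y P \<omega> \<in> S_NN - S_infinity)"
proof -
  interpret prob_space M by fact
  interpret limit_setup M X Y P
    by unfold_locales fact+
  show ?thesis by (rule limit_perm_limit_law)
qed

end
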